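(* There is a polynomial time algorithm which decides, for a given digraph $D=(V,A)$, whether $D$ contains a spanning antistrong subdigraph $H=(V,A')$ such that the underlying graph $UG(D-A')$ of the digraph $D-A'=(V,A\setminus A')$ is connected.
   Context: Digraphs are finite and loopless. The underlying graph $UG(D)$ of a digraph $D$ is obtained by ignoring arc orientations and deleting one copy of each pair of parallel edges arising from 2-cycles. In a walk (in the underlying graph) an arc $vw$ is forward if traversed from $v$ to $w$ and backward if traversed from $w$ to $v$. An antidirected trail is a walk with no repeated arc whose arcs alternate between forward and backward; it is a forward antidirected trail if it begins and ends with a forward arc. A digraph is antistrong if it has at least three vertices and contains a forward antidirected $(x,y)$-trail for every pair of distinct vertices $x,y$. *)

theory Defs
  imports "Graph_Theory.Digraph_Component" "HOL-Computational_Algebra.Polynomial"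
begin

section \<open>Antistrong digraphs\<close>

text \<open>
  A finite loopless digraph without parallel arcs is a \<^locale>\<open>pair_digraph\<close>; 2-cycles are allowed.

  A step \<open>(a, True)\<close> traverses the arc \<open>a\<close> forward, from its tail to its head, and
  \<open>(a, False)\<close> traverses it backward. The two arcs of a 2-cycle are different arcs, so a
  trail may use both.
\<close>

fun walk :: "'a pair_pre_digraph \<Rightarrow> 'a \<Rightarrow> (('a \<times> 'a) \<times> bool) list \<Rightarrow> 'a \<Rightarrow> bool" where
  "walk D x [] y \<longleftrightarrow> x = y \<and> x \<in> pverts D"
| "walk D x (((u, v), forward) # p) y \<longleftrightarrow>
     (u, v) \<in> parcs D \<and>
     (if forward then x = u \<and> walk D v p y else x = v \<and> walk D u p y)"

definition antidirected_trail ::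
    "'a pair_pre_digraph \<Rightarrow> 'a \<Rightarrow> (('a \<times> 'a) \<times> bool) list \<Rightarrow> 'a \<Rightarrow> bool" where
  "antidirected_trail D x p y \<longleftrightarrow>
     walk D x p y \<and> distinct (map fst p) \<and> successively (\<lambda>s t. snd s \<noteq> snd t) p"

definition forward_antidirected_trail ::
    "'a pair_pre_digraph \<Rightarrow> 'a \<Rightarrow> (('a \<times> 'a) \<times> bool) list \<Rightarrow> 'a \<Rightarrow> bool" where
  "forward_antidirected_trail D x p y \<longleftrightarrow>
     antidirected_trail D x p y \<and> p \<noteq> [] \<and> snd (hd p) \<and> snd (last p)"

definition antistrong :: "'a pair_pre_digraph \<Rightarrow> bool" where
  "antistrong D \<longleftrightarrow> 3 \<le> card (pverts D) \<and>
     (\<forall>x \<in> pverts D. \<forall>y \<in> pverts D. x \<noteq> y \<longrightarrow> (\<exists>p. forward_antidirected_trail D x p y))"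


section \<open>Polynomial time\<close>

text \<open>
  The model of computation is the random access machine with unit cost and with addition and
  truncated subtraction as its only arithmetic. As there is no multiplication or shift, a step at
  most doubles the largest number present, so the numbers occurring in the first \<open>t\<close> steps have
  \<open>O(t + log n)\<close> bits on inputs of length \<open>n\<close>. Hence polynomial time on this machine is the same
  as polynomial time on Turing machines (Cook and Reckhow 1973).

  A machine has registers, which instructions name directly (so a program uses only finitely many
  of them), and a separate memory, which is accessed through addresses held in registers.
\<close>

datatype instr =
    Imm nat nat       \<comment> \<open>\<open>R[i] := k\<close>\<close>
  | Add nat nat nat   \<comment> \<open>\<open>R[i] := R[j] + R[k]\<close>\<close>
  | Sub nat nat nat   \<comment> \<open>\<open>R[i] := R[j] - R[k]\<close>, or 0 if this is negative\<close>
  | Load nat nat      \<comment> \<open>\<open>R[i] := M[R[j]]\<close>\<close>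
  | Store nat nat     \<comment> \<open>\<open>M[R[i]] := R[j]\<close>\<close>
  | Jump_Zero nat nat \<comment> \<open>continue at instruction \<open>l\<close> if \<open>R[i] = 0\<close>\<close>

text \<open>Program counter, registers, memory.\<close>

type_synonym config = "nat \<times> (nat \<Rightarrow> nat) \<times> (nat \<Rightarrow> nat)"

fun exec :: "instr \<Rightarrow> config \<Rightarrow> config" where
  "exec (Imm i k) (pc, R, M) = (Suc pc, R(i := k), M)"
| "exec (Add i j k) (pc, R, M) = (Suc pc, R(i := R j + R k), M)"
| "exec (Sub i j k) (pc, R, M) = (Suc pc, R(i := R j - R k), M)"
| "exec (Load i j) (pc, R, M) = (Suc pc, R(i := M (R j)), M)"
| "exec (Store i j) (pc, R, M) = (Suc pc, R, M(R i := R j))"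
| "exec (Jump_Zero i l) (pc, R, M) = (if R i = 0 then l else Suc pc, R, M)"

definition halted :: "instr list \<Rightarrow> config \<Rightarrow> bool" where
  "halted P c \<longleftrightarrow> length P \<le> fst c"

definition step :: "instr list \<Rightarrow> config \<Rightarrow> config" where
  "step P c = (if halted P c then c else exec (P ! fst c) c)"

text \<open>The input is a bit string, given in the memory, with its length in register 0.\<close>

definition init :: "bool list \<Rightarrow> config" where
  "init w = (0, (\<lambda>_. 0)(0 := length w), \<lambda>a. if a < length w \<and> w ! a then 1 else 0)"

definition accepting :: "config \<Rightarrow> bool" where
  "accepting c \<longleftrightarrow> fst (snd c) 0 \<noteq> 0"

text \<open>
  The program \<open>P\<close> decides the property \<open>Q\<close> of the instances in \<open>I\<close>, encoded by \<open>enc\<close>, in time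
  polynomial in the length of the encoding.
\<close>

definition decides_in_poly_time ::
    "instr list \<Rightarrow> 'i set \<Rightarrow> ('i \<Rightarrow> bool list) \<Rightarrow> ('i \<Rightarrow> bool) \<Rightarrow> bool" where
  "decides_in_poly_time P I enc Q \<longleftrightarrow>
     (\<exists>p :: nat poly. \<forall>x \<in> I. \<exists>t \<le> poly p (length (enc x)).
        let c = (step P ^^ t) (init (enc x)) in halted P c \<and> (accepting c \<longleftrightarrow> Q x))"

text \<open>The rows of the adjacency matrix of \<open>D\<close> for the listing \<open>vs\<close> of its vertices.\<close>

definition adjacency_bits :: "'a pair_pre_digraph \<Rightarrow> 'a list \<Rightarrow> bool list" where
  "adjacency_bits D vs = concat (map (\<lambda>u. map (\<lambda>v. (u, v) \<in> parcs D) vs) vs)"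

end

theory Submission
  imports Defs
begin

text \<open>
  A forward antidirected trail from \<open>x\<close> to \<open>y\<close> is a trail from the tail copy of \<open>x\<close> to the head
  copy of \<open>y\<close> in the bipartite graph that has an edge between the tail copy of \<open>u\<close> and the head
  copy of \<open>v\<close> for each arc \<open>uv\<close>. Hence a digraph on at least three vertices is antistrong iff this
  graph is connected, and the question is whether the arcs can be split into two parts, one spanning
  in the graphic matroid of the bipartite graph and one in that of the underlying graph.

  Disjoint independent sets \<open>I\<^sub>0\<close>, \<open>I\<^sub>1\<close> are augmented as in matroid union. Starting from \<open>S = A\<close>,
  replace \<open>S\<close> by \<open>S \<inter> cl\<^sub>0 (I\<^sub>0 \<inter> S) \<inter> cl\<^sub>1 (I\<^sub>1 \<inter> S)\<close> until an uncovered arc \<open>e\<close> is about to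
  drop out, because \<open>e \<notin> cl\<^sub>j (I\<^sub>j \<inter> S)\<close>. Then \<open>e\<close> enters \<open>I\<^sub>j\<close>, and if it closes a circuit there,
  some \<open>x \<notin> S\<close> of that circuit leaves. This \<open>x\<close> drops out one stage earlier than \<open>e\<close>, so that a
  polynomial number of such steps enlarges \<open>I\<^sub>0 \<union> I\<^sub>1\<close>. If \<open>S\<close> becomes stable while it contains
  every uncovered arc, then counting inside and outside \<open>S\<close> shows that \<open>I\<^sub>0 \<union> I\<^sub>1\<close> is as large as
  possible.

  A step of this procedure is first-order definable up to reachability, so it is written in a small
  language of updates of binary relations by first-order formulas and of loops of length \<open>n\<close>.
  Programs of this language run in polynomial time by construction.
\<close>

section \<open>Programs over bounded first-order formulas\<close>

text \<open>An upper bound on the number of steps, rather than the exact number, lets costs be added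
  along a run and rounded up freely.\<close>

definition runs :: "instr list \<Rightarrow> nat \<Rightarrow> config \<Rightarrow> config \<Rightarrow> bool" where
  "runs P b c c' \<longleftrightarrow> (\<exists>t\<le>b. (step P ^^ t) c = c')"

lemma runs_refl [simp]: "runs P b c c"
  unfolding runs_def by (rule exI[of _ 0]) simp

lemma runs_trans: "runs P a c c' \<Longrightarrow> runs P b c' c'' \<Longrightarrow> a + b \<le> k \<Longrightarrow> runs P k c c''"
  unfolding runs_def
proof clarify
  fix s t assume "s \<le> a" "t \<le> b" "a + b \<le> k"
  then show "\<exists>r\<le>k. (step P ^^ r) c = (step P ^^ t) ((step P ^^ s) c)"
    by (intro exI[of _ "t + s"]) (simp add: funpow_add)
qed

lemma runs_step:
  "pc < length P \<Longrightarrow> runs P b (exec (P ! pc) (pc, R, M)) c' \<Longrightarrow>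
     runs P (Suc b) (pc, R, M) c'"
  unfolding runs_def
proof clarify
  fix t assume "pc < length P" "t \<le> b" "c' = (step P ^^ t) (exec (P ! pc) (pc, R, M))"
  then show "\<exists>r\<le>Suc b. (step P ^^ r) (pc, R, M) = (step P ^^ t) (exec (P ! pc) (pc, R, M))"
    by (intro exI[of _ "Suc t"]) (simp add: funpow_swap1 step_def halted_def)
qed

fun code_at :: "instr list \<Rightarrow> nat \<Rightarrow> instr list \<Rightarrow> bool" where
  "code_at P off [] \<longleftrightarrow> True"
| "code_at P off (i # is) \<longleftrightarrow> off < length P \<and> P ! off = i \<and> code_at P (Suc off) is"

lemma code_at_append [simp]:
  "code_at P off (xs @ ys) \<longleftrightarrow> code_at P off xs \<and> code_at P (off + length xs) ys"
  by (induction xs arbitrary: off) auto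

lemma code_at_self: "code_at (xs @ ys) (length xs) ys"
proof (induction ys arbitrary: xs)
  case (Cons y ys)
  from this[of "xs @ [y]"] show ?case by simp
qed simp

section \<open>First-order formulas over the numbers below n and their evaluation by the
  machine\<close>

datatype fm =
    Rel nat nat nat
  | Less nat nat
  | Neg fm
  | Conj fm fm
  | Forall fm

type_synonym store = "nat \<Rightarrow> (nat \<times> nat) set"

text \<open>Variables are de Bruijn levels: a quantifier below \<open>d\<close> binders binds variable \<open>d\<close>.\<close>

fun eval :: "nat \<Rightarrow> nat list \<Rightarrow> store \<Rightarrow> fm \<Rightarrow> bool" where
  "eval n env st (Rel k i j) \<longleftrightarrow> (env ! i, env ! j) \<in> st k"
| "eval n env st (Less i j) \<longleftrightarrow> env ! i < env ! j"
| "eval n env st (Neg \<phi>) \<longleftrightarrow> \<not> eval n env st \<phi>"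
| "eval n env st (Conj \<phi> \<psi>) \<longleftrightarrow> eval n env st \<phi> \<and> eval n env st \<psi>"
| "eval n env st (Forall \<phi>) \<longleftrightarrow> (\<forall>x<n. eval n (env @ [x]) st \<phi>)"

fun fm_wf :: "nat \<Rightarrow> fm \<Rightarrow> bool" where
  "fm_wf d (Rel k i j) \<longleftrightarrow> i < d \<and> j < d"
| "fm_wf d (Less i j) \<longleftrightarrow> i < d \<and> j < d"
| "fm_wf d (Neg \<phi>) \<longleftrightarrow> fm_wf d \<phi>"
| "fm_wf d (Conj \<phi> \<psi>) \<longleftrightarrow> fm_wf d \<phi> \<and> fm_wf d \<psi>"
| "fm_wf d (Forall \<phi>) \<longleftrightarrow> fm_wf (Suc d) \<phi>"

text \<open>
  Register 0 holds \<open>n * n\<close>, register 1 holds \<open>n\<close>, registers 2 and 3 hold the constants 1 and 0,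
  and registers 4 and 5 are scratch, with truth values left in register 5. Variable \<open>i\<close> is
  kept in register \<open>7 + 2 * i\<close>, and its multiple by \<open>n\<close> in register \<open>8 + 2 * i\<close>, so that
  addresses are found without multiplication. Relation \<open>k\<close> is the \<open>k\<close>-th block of \<open>n * n\<close> cells.
\<close>

definition addr_code :: "nat \<Rightarrow> nat \<Rightarrow> nat \<Rightarrow> instr list" where
  "addr_code k i j = Add 4 (8 + 2 * i) (7 + 2 * j) # replicate k (Add 4 4 0)"

text \<open>Register 3 is 0, so the closing \<open>Jump_Zero 3\<close> is unconditional. The counter
  and its multiple by \<open>n\<close> advance together, by 1 and by \<open>n\<close>.\<close>

definition loop_code :: "nat \<Rightarrow> nat \<Rightarrow> nat \<Rightarrow> instr list \<Rightarrow> instr list" where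
  "loop_code d off out body =
     [Imm (7 + 2 * d) 0, Imm (8 + 2 * d) 0, Sub 5 1 (7 + 2 * d), Jump_Zero 5 out] @ body @
     [Add (7 + 2 * d) (7 + 2 * d) 2, Add (8 + 2 * d) (8 + 2 * d) 1, Jump_Zero 3 (off + 2)]"

text \<open>Jump targets are absolute, hence the parameter \<open>off\<close>. A false first
  conjunct skips the second. A universal quantifier leaves its loop at the first counterexample,
  jumping past the final \<open>Imm 5 1\<close> with register 5 still 0.\<close>

fun fm_code :: "nat \<Rightarrow> nat \<Rightarrow> fm \<Rightarrow> instr list" where
  "fm_code d off (Rel k i j) = addr_code k i j @ [Load 5 4]"
| "fm_code d off (Less i j) = [Sub 5 (7 + 2 * j) (7 + 2 * i)]"
| "fm_code d off (Neg \<phi>) = fm_code d off \<phi> @ [Sub 5 2 5]"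
| "fm_code d off (Conj \<phi> \<psi>) =
     (let c = fm_code d off \<phi>; c' = fm_code d (Suc (off + length c)) \<psi>
      in c @ [Jump_Zero 5 (Suc (off + length c + length c'))] @ c')"
| "fm_code d off (Forall \<phi>) =
     (let c = fm_code (Suc d) (off + 4) \<phi>
      in loop_code d off (off + 8 + length c) (c @ [Jump_Zero 5 (off + 9 + length c)]) @ [Imm 5 1])"

text \<open>A polynomial in \<open>n\<close>: each quantifier contributes a factor
  \<open>[:0, 1:]\<close>. The \<open>k + 2\<close> of an atom pays for the address, with
  \<open>k\<close> additions of \<open>n * n\<close>, and for the load.\<close>

fun fm_cost :: "fm \<Rightarrow> nat poly" where
  "fm_cost (Rel k i j) = [:k + 2:]"
| "fm_cost (Less i j) = [:1:]"
| "fm_cost (Neg \<phi>) = fm_cost \<phi> + [:1:]"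
| "fm_cost (Conj \<phi> \<psi>) = fm_cost \<phi> + fm_cost \<psi> + [:1:]"
| "fm_cost (Forall \<phi>) = [:0, 1:] * (fm_cost \<phi> + [:6:]) + [:5:]"

definition rep :: "nat \<Rightarrow> nat list \<Rightarrow> store \<Rightarrow> (nat \<Rightarrow> nat) \<Rightarrow> (nat \<Rightarrow> nat) \<Rightarrow> bool" where
  "rep n env st R M \<longleftrightarrow> R 0 = n * n \<and> R 1 = n \<and> R 2 = 1 \<and> R 3 = 0 \<and>
     (\<forall>i<length env. env ! i < n \<and> R (7 + 2 * i) = env ! i \<and> R (8 + 2 * i) = env ! i * n) \<and>
     (\<forall>k. \<forall>u<n. \<forall>v<n. (u, v) \<in> st k \<longleftrightarrow> M (u * n + v + k * (n * n)) \<noteq> 0)"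

lemma rep_scratch [simp]:
  "rep n env st (R(4 := x)) M = rep n env st R M"
  "rep n env st (R(5 := x)) M = rep n env st R M"
  by (auto simp: rep_def)

lemma odd_even_neq: "7 + 2 * i \<noteq> 8 + 2 * (j :: nat)"
  by presburger

lemma rep_append:
  "rep n (env @ [x]) st R M \<longleftrightarrow> rep n env st R M \<and> x < n \<and>
     R (7 + 2 * length env) = x \<and> R (8 + 2 * length env) = x * n"
  by (auto simp: rep_def nth_append less_Suc_eq)

lemma rep_upd:
  "rep n env st R M \<Longrightarrow> rep n env st (R(7 + 2 * length env := x)) M"
  "rep n env st R M \<Longrightarrow> rep n env st (R(8 + 2 * length env := x)) M"
  using odd_even_neq[of "length env"] odd_even_neq[of _ "length env"]
  by (auto simp: rep_def)

lemma addr_code_runs: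
  assumes "code_at P off (addr_code k i j)" "rep n env st R M" "i < length env" "j < length env"
  shows "runs P (Suc k) (off, R, M)
    (off + Suc k, R(4 := env ! i * n + env ! j + k * (n * n)), M)"
proof -
  have add: "runs P k (off, R(4 := a), M) (off + k, R(4 := a + k * (n * n)), M)"
    if "code_at P off (replicate k (Add 4 4 0))" for off a
    using that
  proof (induction k arbitrary: off a)
    case (Suc k)
    have R: "R 0 = n * n" using assms(2) by (simp add: rep_def)
    from Suc.prems have "runs P k (Suc off, R(4 := a + n * n), M)
        (Suc off + k, R(4 := a + n * n + k * (n * n)), M)"
      by (intro Suc.IH) simp
    with Suc.prems R have "runs P (Suc k) (off, R(4 := a), M)
        (Suc off + k, R(4 := a + n * n + k * (n * n)), M)"
      by (intro runs_step) simp_all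
    then show ?case by (simp only: add.assoc mult_Suc add_Suc_right add_Suc)
  qed simp
  have "R (8 + 2 * i) = env ! i * n" "R (7 + 2 * j) = env ! j"
    using assms by (auto simp: rep_def)
  with add[of "Suc off" "env ! i * n + env ! j"] assms(1) show ?thesis
    by (auto intro!: runs_step simp: addr_code_def)
qed

lemma length_addr_code [simp]: "length (addr_code k i j) = Suc k"
  by (simp add: addr_code_def)

text \<open>
  \<open>Q x\<close> is the invariant after \<open>x\<close> rounds. The body may end the loop early by jumping
  elsewhere, in a configuration that satisfies \<open>E\<close>.
\<close>

lemma loop_code_runs:
  fixes Q :: "nat \<Rightarrow> (nat \<Rightarrow> nat) \<Rightarrow> (nat \<Rightarrow> nat) \<Rightarrow> bool"
  assumes code: "code_at P off (loop_code d off out body)"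
    and d: "d = length env"
    and body: "\<And>x R M. x < n \<Longrightarrow> Q x R M \<Longrightarrow> rep n (env @ [x]) (st x) R M \<Longrightarrow>
       \<exists>c. runs P b (off + 4, R, M) c \<and>
         (E c \<or> (\<exists>R M. c = (off + 4 + length body, R, M) \<and> rep n (env @ [x]) (st (Suc x)) R M \<and> Q (Suc x) R M))"
    and Q: "\<And>x R M y z w. Q x R M \<Longrightarrow> Q x (R(7 + 2 * d := y, 8 + 2 * d := z, 5 := w)) M"
    and start: "rep n env (st 0) R M" "Q 0 R M"
  shows "\<exists>c. runs P (n * (b + 5) + 4) (off, R, M) c \<and>
     (E c \<or> (\<exists>R M. c = (out, R, M) \<and> rep n env (st n) R M \<and> Q n R M))"
proof -
  let ?v = "7 + 2 * d" and ?w = "8 + 2 * d"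
  have at: "code_at P (off + 4) body"
    "off + 3 < length P" "P ! off = Imm ?v 0" "P ! (off + 1) = Imm ?w 0"
    "P ! (off + 2) = Sub 5 1 ?v" "P ! (off + 3) = Jump_Zero 5 out"
    "off + 6 + length body < length P"
    "P ! (off + 4 + length body) = Add ?v ?v 2" "P ! (off + 5 + length body) = Add ?w ?w 1"
    "P ! (off + 6 + length body) = Jump_Zero 3 (off + 2)"
    using code by (simp_all add: loop_code_def numeral_eq_Suc)
  \<comment> \<open>Induction on the number \<open>m\<close> of remaining rounds. Besides the body,
    a round costs 2 steps for the test and 3 for the increments and the jump back. The last test
    costs 2, and the two initialisations raise this to the 4 of the claim.\<close>
  have loop: "\<exists>c. runs P (m * (b + 5) + 2) (off + 2, R, M) c \<and>
     (E c \<or> (\<exists>R M. c = (out, R, M) \<and> rep n env (st n) R M \<and> Q n R M))"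
    if "x + m = n" "rep n env (st x) R M" "Q x R M" "R ?v = x" "R ?w = x * n" for m x R M
    using that
  proof (induction m arbitrary: x R M)
    case 0
    then have "R 1 = n" "x = n" by (auto simp: rep_def)
    with 0 have "runs P 2 (off + 2, R, M) (out, R(5 := 0), M)"
      using at unfolding numeral_2_eq_2
      by (intro runs_step) (auto simp: numeral_eq_Suc intro!: runs_step)
    then have "runs P (0 * (b + 5) + 2) (off + 2, R, M) (out, R(5 := 0), M)"
      by (simp only: mult_zero_left add_0)
    moreover have "Q n (R(5 := 0)) M"
      using Q[OF 0(3), of "R ?v" "R ?w" 0] \<open>x = n\<close> by (simp add: fun_upd_idem)
    moreover have "rep n env (st n) (R(5 := 0)) M" using 0 \<open>x = n\<close> by simp
    ultimately show ?case by blast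
  next
    case (Suc m)
    from Suc.prems have "R 1 = n" "x < n" by (auto simp: rep_def)
    let ?R = "R(5 := n - x)"
    have *: "runs P 2 (off + 2, R, M) (off + 4, ?R, M)"
      using at \<open>x < n\<close> \<open>R 1 = n\<close> Suc.prems unfolding numeral_2_eq_2
      by (intro runs_step) (auto simp: numeral_eq_Suc intro!: runs_step)
    have "Q x ?R M"
      using Q[OF Suc.prems(3), of "R ?v" "R ?w" "n - x"] by (simp add: fun_upd_idem)
    moreover have "rep n (env @ [x]) (st x) ?R M"
      using Suc.prems \<open>x < n\<close> d by (simp add: rep_append)
    ultimately obtain c where c: "runs P b (off + 4, ?R, M) c"
      "E c \<or> (\<exists>R M. c = (off + 4 + length body, R, M) \<and> rep n (env @ [x]) (st (Suc x)) R M \<and> Q (Suc x) R M)"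
      using body[OF \<open>x < n\<close>] by blast
    have **: "runs P (b + 2) (off + 2, R, M) c"
      using runs_trans[OF * c(1)] by simp
    show ?case
    proof (cases "E c")
      case True
      moreover have "runs P (Suc m * (b + 5) + 2) (off + 2, R, M) c"
        by (rule runs_trans[OF ** runs_refl[of _ 0]]) simp
      ultimately show ?thesis by blast
    next
      case False
      with c obtain R' M' where R': "c = (off + 4 + length body, R', M')"
        "rep n (env @ [x]) (st (Suc x)) R' M'" "Q (Suc x) R' M'" by blast
      let ?R' = "R'(?v := Suc x, ?w := Suc x * n)"
      have regs: "R' 2 = 1" "R' 1 = n" "R' 3 = 0" "R' ?v = x" "R' ?w = x * n"
        using R'(2) d by (auto simp: rep_def rep_append)
      have "runs P 3 c (off + 2, ?R', M')"
        using at regs unfolding numeral_3_eq_3 R'(1)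
        by (intro runs_step) (auto simp: numeral_eq_Suc add.commute intro!: runs_step)
      from runs_trans[OF ** this]
      have ***: "runs P (b + 5) (off + 2, R, M) (off + 2, ?R', M')" by simp
      have "rep n env (st (Suc x)) ?R' M'"
        using R'(2) d by (intro rep_upd[of n env, folded d]) (auto simp: rep_append)
      moreover have "Q (Suc x) ?R' M'"
        using Q[OF R'(3), of "Suc x" "Suc x * n" "R' 5"]
        by (simp add: fun_upd_idem)
      moreover have "?R' ?v = Suc x" "?R' ?w = Suc x * n"
        by (simp_all add: odd_even_neq)
      ultimately obtain c' where c': "runs P (m * (b + 5) + 2) (off + 2, ?R', M') c'"
        "E c' \<or> (\<exists>R M. c' = (out, R, M) \<and> rep n env (st n) R M \<and> Q n R M)"
        using Suc.IH[of "Suc x" ?R' M'] Suc.prems(1)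
        by (metis add_Suc_shift)
      have "runs P (Suc m * (b + 5) + 2) (off + 2, R, M) c'"
        by (rule runs_trans[OF *** c'(1)]) simp
      with c'(2) show ?thesis by blast
    qed
  qed
  let ?R = "R(?v := 0, ?w := 0)"
  have *: "runs P 2 (off, R, M) (off + 2, ?R, M)"
    using at unfolding numeral_2_eq_2
    by (intro runs_step) (auto simp: numeral_eq_Suc intro!: runs_step)
  have "rep n env (st 0) ?R M"
    using start d by (intro rep_upd[of n env, folded d]) auto
  moreover have "Q 0 ?R M"
    using Q[OF start(2), of 0 0 "R 5"] by (simp add: fun_upd_idem)
  ultimately obtain c where c: "runs P (n * (b + 5) + 2) (off + 2, ?R, M) c"
    "E c \<or> (\<exists>R M. c = (out, R, M) \<and> rep n env (st n) R M \<and> Q n R M)"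
    using loop[of 0 n ?R M] by (metis odd_even_neq fun_upd_apply add_0 mult_zero_left)
  have "runs P (n * (b + 5) + 4) (off, R, M) c"
    by (rule runs_trans[OF * c(1)]) simp
  with c(2) show ?thesis by blast
qed

lemma length_loop_code [simp]: "length (loop_code d off out body) = 7 + length body"
  by (simp add: loop_code_def)

lemma code_at_loop: "code_at P off (loop_code d off out body) \<Longrightarrow> code_at P (off + 4) body"
  by (simp add: loop_code_def numeral_eq_Suc)

lemma fm_code_runs:
  assumes "fm_wf (length env) \<phi>" "rep n env st R M"
    "code_at P off (fm_code (length env) off \<phi>)"
  shows "\<exists>R'. runs P (poly (fm_cost \<phi>) n) (off, R, M)
       (off + length (fm_code (length env) off \<phi>), R', M) \<and>
     rep n env st R' M \<and> (R' 5 \<noteq> 0 \<longleftrightarrow> eval n env st \<phi>)"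
  using assms
proof (induction \<phi> arbitrary: env off R)
  case (Rel k i j)
  let ?a = "env ! i * n + env ! j + k * (n * n)"
  let ?R = "R(4 := ?a, 5 := M ?a)"
  have *: "runs P (Suc k) (off, R, M) (off + Suc k, R(4 := ?a), M)"
    using Rel by (intro addr_code_runs) auto
  have "runs P 1 (off + Suc k, R(4 := ?a), M) (off + Suc (Suc k), ?R, M)"
    unfolding One_nat_def using Rel(3) by (intro runs_step) auto
  from runs_trans[OF * this]
  have "runs P (poly (fm_cost (Rel k i j)) n) (off, R, M)
      (off + length (fm_code (length env) off (Rel k i j)), ?R, M)" by simp
  moreover have "rep n env st ?R M" using Rel by simp
  moreover have "?R 5 \<noteq> 0 \<longleftrightarrow> eval n env st (Rel k i j)"
    using Rel by (auto simp: rep_def)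
  ultimately show ?case by blast
next
  case (Less i j)
  let ?R = "R(5 := env ! j - env ! i)"
  have "runs P 1 (off, R, M) (Suc off, ?R, M)"
    unfolding One_nat_def using Less by (intro runs_step) (auto simp: rep_def)
  then have "runs P (poly (fm_cost (Less i j)) n) (off, R, M)
      (off + length (fm_code (length env) off (Less i j)), ?R, M)" by simp
  moreover have "rep n env st ?R M" "?R 5 \<noteq> 0 \<longleftrightarrow> eval n env st (Less i j)"
    using Less by auto
  ultimately show ?case by blast
next
  case (Neg \<phi>)
  then obtain R' where R': "runs P (poly (fm_cost \<phi>) n) (off, R, M)
      (off + length (fm_code (length env) off \<phi>), R', M)"
    "rep n env st R' M" "R' 5 \<noteq> 0 \<longleftrightarrow> eval n env st \<phi>"
    by fastforce
  have "R' 2 = 1" using R'(2) by (simp add: rep_def)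
  then have "runs P 1 (off + length (fm_code (length env) off \<phi>), R', M)
      (off + Suc (length (fm_code (length env) off \<phi>)), R'(5 := 1 - R' 5), M)"
    unfolding One_nat_def using Neg by (intro runs_step) auto
  from runs_trans[OF R'(1) this]
  have "runs P (poly (fm_cost (Neg \<phi>)) n) (off, R, M)
      (off + length (fm_code (length env) off (Neg \<phi>)), R'(5 := 1 - R' 5), M)" by simp
  moreover have "rep n env st (R'(5 := 1 - R' 5)) M"
    "(R'(5 := 1 - R' 5)) 5 \<noteq> 0 \<longleftrightarrow> eval n env st (Neg \<phi>)"
    using R' by auto
  ultimately show ?case by blast
next
  case (Conj \<phi> \<psi>)
  let ?d = "length env"
  define l where "l = length (fm_code ?d off \<phi>)"
  define l' where "l' = length (fm_code ?d (Suc (off + l)) \<psi>)"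
  have len: "length (fm_code ?d off (Conj \<phi> \<psi>)) = Suc (l + l')"
    by (simp add: Let_def l_def l'_def)
  have code: "code_at P off (fm_code ?d off \<phi>)" "off + l < length P"
    "P ! (off + l) = Jump_Zero 5 (Suc (off + l + l'))"
    "code_at P (Suc (off + l)) (fm_code ?d (Suc (off + l)) \<psi>)"
    using Conj.prems(3) by (simp_all add: Let_def l_def l'_def)
  obtain R1 where R1: "runs P (poly (fm_cost \<phi>) n) (off, R, M) (off + l, R1, M)"
    "rep n env st R1 M" "R1 5 \<noteq> 0 \<longleftrightarrow> eval n env st \<phi>"
    unfolding l_def using Conj.IH(1) Conj.prems code(1) by force
  have jump: "runs P 1 (off + l, R1, M)
      (if R1 5 = 0 then off + Suc (l + l') else Suc (off + l), R1, M)"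
    unfolding One_nat_def using code by (intro runs_step) (auto simp: add_ac)
  show ?case
  proof (cases "R1 5 = 0")
    case True
    from runs_trans[OF R1(1) jump, of "poly (fm_cost (Conj \<phi> \<psi>)) n"] True R1 len
    show ?thesis by (intro exI[of _ R1]) auto
  next
    case False
    obtain R2 where R2: "runs P (poly (fm_cost \<psi>) n) (Suc (off + l), R1, M) (Suc (off + l) + l', R2, M)"
      "rep n env st R2 M" "R2 5 \<noteq> 0 \<longleftrightarrow> eval n env st \<psi>"
      unfolding l'_def using Conj.IH(2)[OF _ R1(2) code(4)] Conj.prems(1) by force
    from runs_trans[OF R1(1) jump, OF order_refl] False
    have "runs P (poly (fm_cost \<phi>) n + 1) (off, R, M) (Suc (off + l), R1, M)" by simp
    from runs_trans[OF this R2(1), of "poly (fm_cost (Conj \<phi> \<psi>)) n"]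
    show ?thesis using R1 R2 False len by (intro exI[of _ R2]) (auto simp: add.assoc)
  qed
next
  case (Forall \<phi>)
  let ?d = "length env"
  let ?c = "fm_code (Suc ?d) (off + 4) \<phi>"
  define l where "l = length ?c"
  have len: "length (fm_code ?d off (Forall \<phi>)) = l + 9"
    by (simp add: Let_def l_def)
  have code: "code_at P off (loop_code ?d off (off + 8 + l) (?c @ [Jump_Zero 5 (off + 9 + l)]))"
    "off + 8 + l < length P" "P ! (off + 8 + l) = Imm 5 1"
    using Forall.prems(3) by (simp_all add: Let_def l_def numeral_eq_Suc)
  have body: "code_at P (off + 4) ?c" "off + 4 + l < length P"
     "P ! (off + 4 + l) = Jump_Zero 5 (off + 9 + l)"
    using code_at_loop[OF code(1)] by (simp_all add: l_def)
  have six: "m + 1 + 5 = m + 6" for m :: nat by simp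
  \<comment> \<open>\<open>E\<close> describes the early exit with a counterexample,
    \<open>Q\<close> the invariant that all values tried so far satisfy the formula.\<close>
  define E where "E c \<longleftrightarrow> (\<exists>R. c = (off + 9 + l, R, M) \<and> rep n env st R M \<and> R 5 = 0 \<and>
      \<not> eval n env st (Forall \<phi>))" for c
  define Q where "Q x (R :: nat \<Rightarrow> nat) M' \<longleftrightarrow> M' = M \<and> (\<forall>y<x. eval n (env @ [y]) st \<phi>)" for x R M'
  have "\<exists>c. runs P (n * (poly (fm_cost \<phi>) n + 1 + 5) + 4) (off, R, M) c \<and>
     (E c \<or> (\<exists>R M. c = (off + 8 + l, R, M) \<and> rep n env st R M \<and> Q n R M))"
  proof (rule loop_code_runs[OF code(1) refl])
    fix x R M'
    assume x: "x < n" "Q x R M'" "rep n (env @ [x]) st R M'"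
    then have [simp]: "M' = M" by (simp add: Q_def)
    obtain R1 where R1: "runs P (poly (fm_cost \<phi>) n) (off + 4, R, M) (off + 4 + l, R1, M)"
      "rep n (env @ [x]) st R1 M" "R1 5 \<noteq> 0 \<longleftrightarrow> eval n (env @ [x]) st \<phi>"
      using Forall.IH[of "env @ [x]" R "off + 4"] Forall.prems x body unfolding l_def by auto
    have jump: "runs P 1 (off + 4 + l, R1, M)
        (if R1 5 = 0 then off + 9 + l else off + 4 + Suc l, R1, M)"
      unfolding One_nat_def using body by (intro runs_step) auto
    note run = runs_trans[OF R1(1) jump, OF order_refl]
    show "\<exists>c. runs P (poly (fm_cost \<phi>) n + 1) (off + 4, R, M') c \<and>
         (E c \<or> (\<exists>R M. c = (off + 4 + length (?c @ [Jump_Zero 5 (off + 9 + l)]), R, M) \<and>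
           rep n (env @ [x]) st R M \<and> Q (Suc x) R M))"
    proof (cases "R1 5 = 0")
      case True
      then have "E (off + 9 + l, R1, M)"
        using R1 x by (auto simp: E_def rep_append)
      with run True show ?thesis by auto
    next
      case False
      then have "Q (Suc x) R1 M"
        using R1 x by (auto simp: Q_def less_Suc_eq)
      with run False R1(2) show ?thesis
        by (intro exI[of _ "(off + 4 + Suc l, R1, M)"]) (simp add: l_def)
    qed
  qed (use Forall.prems in \<open>auto simp: Q_def\<close>)
  then obtain c where c: "runs P (n * (poly (fm_cost \<phi>) n + 6) + 4) (off, R, M) c"
    "E c \<or> (\<exists>R M. c = (off + 8 + l, R, M) \<and> rep n env st R M \<and> Q n R M)"
    unfolding six by blast
  show ?case
  proof (cases "E c")
    case True
    then obtain R' where R': "c = (off + 9 + l, R', M)" "rep n env st R' M" "R' 5 = 0"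
      "\<not> eval n env st (Forall \<phi>)" unfolding E_def by blast
    have "runs P (poly (fm_cost (Forall \<phi>)) n) (off, R, M) c"
      by (rule runs_trans[OF c(1) runs_refl[of _ 0]]) simp
    moreover have "c = (off + length (fm_code ?d off (Forall \<phi>)), R', M)"
      unfolding len R'(1) by simp
    ultimately show ?thesis using R'(2-4) by blast
  next
    case False
    with c obtain R' where R': "c = (off + 8 + l, R', M)" "rep n env st R' M"
      "\<forall>y<n. eval n (env @ [y]) st \<phi>" unfolding Q_def by blast
    have "runs P 1 c (off + 9 + l, R'(5 := 1), M)"
      unfolding One_nat_def R'(1) using code(2,3) by (intro runs_step) (auto simp: add_ac)
    from runs_trans[OF c(1) this, of "poly (fm_cost (Forall \<phi>)) n"]
    have "runs P (poly (fm_cost (Forall \<phi>)) n) (off, R, M)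
        (off + length (fm_code ?d off (Forall \<phi>)), R'(5 := 1), M)"
      unfolding len by (simp add: add_ac)
    moreover have "rep n env st (R'(5 := 1)) M" "(R'(5 := 1)) 5 \<noteq> 0 \<longleftrightarrow> eval n env st (Forall \<phi>)"
      using R' by auto
    ultimately show ?thesis by blast
  qed
qed

section \<open>Programs that update relations pair by pair in loops of length n\<close>

datatype com =
    Put nat nat nat fm
  | Seq com com
  | For com

text \<open>Relations are truncated to \<open>{..<n}\<close>, as a block of memory has no room for other pairs.\<close>

fun sem :: "nat \<Rightarrow> nat list \<Rightarrow> com \<Rightarrow> store \<Rightarrow> store" where
  "sem n env (Put k i j \<phi>) st =
     st(k := (if eval n env st \<phi> then insert (env ! i, env ! j) else (\<lambda>X. X - {(env ! i, env ! j)}))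
       (st k \<inter> {..<n} \<times> {..<n}))"
| "sem n env (Seq c c') st = sem n env c' (sem n env c st)"
| "sem n env (For c) st = fold (\<lambda>x. sem n (env @ [x]) c) [0..<n] st"

fun com_wf :: "nat \<Rightarrow> com \<Rightarrow> bool" where
  "com_wf d (Put k i j \<phi>) \<longleftrightarrow> i < d \<and> j < d \<and> fm_wf d \<phi>"
| "com_wf d (Seq c c') \<longleftrightarrow> com_wf d c \<and> com_wf d c'"
| "com_wf d (For c) \<longleftrightarrow> com_wf (Suc d) c"

fun com_code :: "nat \<Rightarrow> nat \<Rightarrow> com \<Rightarrow> instr list" where
  "com_code d off (Put k i j \<phi>) = fm_code d off \<phi> @ addr_code k i j @ [Store 4 5]"
| "com_code d off (Seq c c') =
     (let is = com_code d off c in is @ com_code d (off + length is) c')"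
| "com_code d off (For c) =
     (let is = com_code (Suc d) (off + 4) c in loop_code d off (off + 7 + length is) is)"

text \<open>All loops have length \<open>n\<close>, so a polynomial bound can be read off the text
  of the program. The constants for a loop are those of \<open>loop_code_runs\<close>.\<close>

fun com_cost :: "com \<Rightarrow> nat poly" where
  "com_cost (Put k i j \<phi>) = fm_cost \<phi> + [:k + 2:]"
| "com_cost (Seq c c') = com_cost c + com_cost c'"
| "com_cost (For c) = [:0, 1:] * (com_cost c + [:5:]) + [:4:]"

text \<open>In base \<open>n\<close> the last two digits of the address are \<open>v\<close> and
  \<open>u\<close>, and the rest is \<open>k\<close>. Hence writing a cell affects no other pair and
  no other relation.\<close>

lemma address_inj:
  fixes n :: nat
  assumes "u * n + v + k * (n * n) = u' * n + v' + k' * (n * n)" "u < n" "v < n" "u' < n" "v' < n"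
  shows "k = k' \<and> u = u' \<and> v = v'"
proof -
  have eq: "v + n * (u + n * k) = v' + n * (u' + n * k')"
    using assms(1) by (simp add: algebra_simps)
  then have "(v + n * (u + n * k)) mod n = (v' + n * (u' + n * k')) mod n"
    "(v + n * (u + n * k)) div n = (v' + n * (u' + n * k')) div n" by simp_all
  then have v: "v = v'" and uk: "u + n * k = u' + n * k'"
    using assms by (simp_all add: mod_less div_mult_self2)
  from uk have "(u + n * k) mod n = (u' + n * k') mod n" "(u + n * k) div n = (u' + n * k') div n"
    by simp_all
  with v show ?thesis using assms by (simp add: mod_less div_mult_self2)
qed

lemma rep_store:
  assumes "rep n env st R M" "u < n" "v < n"
  shows "rep n env (st(k := (if b \<noteq> 0 then insert (u, v) else (\<lambda>X. X - {(u, v)}))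
       (st k \<inter> {..<n} \<times> {..<n}))) R (M(u * n + v + k * (n * n) := b))"
proof -
  have "u' * n + v' + k' * (n * n) = u * n + v + k * (n * n) \<longleftrightarrow> k' = k \<and> u' = u \<and> v' = v"
    if "u' < n" "v' < n" for u' v' k'
    using address_inj[of u' n v' k' u v k] that assms by auto
  with assms show ?thesis unfolding rep_def by auto
qed

lemma com_code_runs:
  assumes "com_wf (length env) c" "rep n env st R M"
    "code_at P off (com_code (length env) off c)"
  shows "\<exists>R' M'. runs P (poly (com_cost c) n) (off, R, M)
       (off + length (com_code (length env) off c), R', M') \<and> rep n env (sem n env c st) R' M'"
  using assms
proof (induction c arbitrary: env off st R M)
  case (Put k i j \<phi>)
  define l where "l = length (fm_code (length env) off \<phi>)"
  let ?a = "env ! i * n + env ! j + k * (n * n)"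
  obtain R1 where R1: "runs P (poly (fm_cost \<phi>) n) (off, R, M) (off + l, R1, M)"
    "rep n env st R1 M" "R1 5 \<noteq> 0 \<longleftrightarrow> eval n env st \<phi>"
    using fm_code_runs[of env \<phi> n st R M P off] Put.prems unfolding l_def by auto
  have *: "runs P (Suc k) (off + l, R1, M) (off + l + Suc k, R1(4 := ?a), M)"
    using Put R1 by (intro addr_code_runs) (auto simp: l_def)
  let ?M = "M(?a := R1 5)"
  have **: "runs P 1 (off + l + Suc k, R1(4 := ?a), M) (off + (l + Suc (Suc k)), R1(4 := ?a), ?M)"
    unfolding One_nat_def using Put.prems(3) by (intro runs_step) (auto simp: l_def add_ac)
  have "runs P (poly (com_cost (Put k i j \<phi>)) n) (off, R, M) (off + (l + Suc (Suc k)), R1(4 := ?a), ?M)"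
    by (rule runs_trans[OF runs_trans[OF R1(1) *, OF order_refl] **]) simp
  moreover have "l + Suc (Suc k) = length (com_code (length env) off (Put k i j \<phi>))"
    by (simp add: l_def)
  moreover have "rep n env (sem n env (Put k i j \<phi>) st) (R1(4 := ?a)) ?M"
    using rep_store[OF R1(2), of "env ! i" "env ! j" k "R1 5"] Put.prems(1) R1(2,3)
    by (simp only: sem.simps rep_scratch com_wf.simps) (simp add: rep_def)
  ultimately show ?case by metis
next
  case (Seq c1 c2)
  let ?d = "length env"
  define l where "l = length (com_code ?d off c1)"
  define l' where "l' = length (com_code ?d (off + l) c2)"
  have code: "code_at P off (com_code ?d off c1)" "code_at P (off + l) (com_code ?d (off + l) c2)"
    using Seq.prems(3) by (simp_all add: Let_def l_def)
  obtain R1 M1 where 1: "runs P (poly (com_cost c1) n) (off, R, M) (off + l, R1, M1)"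
    "rep n env (sem n env c1 st) R1 M1"
    using Seq.IH(1)[OF _ Seq.prems(2) code(1)] Seq.prems(1) unfolding l_def by auto
  obtain R2 M2 where 2: "runs P (poly (com_cost c2) n) (off + l, R1, M1) (off + l + l', R2, M2)"
    "rep n env (sem n env (Seq c1 c2) st) R2 M2"
    using Seq.IH(2)[OF _ 1(2) code(2)] Seq.prems(1) unfolding l'_def by auto
  have "runs P (poly (com_cost (Seq c1 c2)) n) (off, R, M) (off + l + l', R2, M2)"
    by (rule runs_trans[OF 1(1) 2(1)]) simp
  with 2 show ?case by (auto simp: Let_def l_def l'_def add_ac)
next
  case (For c)
  let ?d = "length env"
  let ?is = "com_code (Suc ?d) (off + 4) c"
  define l where "l = length ?is"
  have code: "code_at P off (loop_code ?d off (off + 7 + l) ?is)"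
    using For.prems(3) by (simp add: Let_def l_def)
  \<comment> \<open>\<open>s m\<close> is the store after \<open>m\<close> rounds. There is no early
    exit, hence \<open>False\<close> and \<open>True\<close> in the places of \<open>E\<close> and
    \<open>Q\<close>.\<close>
  define s where "s m = fold (\<lambda>x. sem n (env @ [x]) c) [0..<m] st" for m
  have "\<exists>c'. runs P (n * (poly (com_cost c) n + 5) + 4) (off, R, M) c' \<and>
     (False \<or> (\<exists>R M. c' = (off + 7 + l, R, M) \<and> rep n env (s n) R M \<and> True))"
  proof (rule loop_code_runs[OF code refl])
    fix x R M
    assume x: "x < n" "rep n (env @ [x]) (s x) R M"
    obtain R1 M1 where 1: "runs P (poly (com_cost c) n) (off + 4, R, M) (off + 4 + l, R1, M1)"
      "rep n (env @ [x]) (sem n (env @ [x]) c (s x)) R1 M1"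
      using For.IH[of "env @ [x]" "s x" R M "off + 4"] For.prems x code_at_loop[OF code]
      unfolding l_def by auto
    moreover have "sem n (env @ [x]) c (s x) = s (Suc x)" by (simp add: s_def)
    ultimately show "\<exists>c'. runs P (poly (com_cost c) n) (off + 4, R, M) c' \<and>
         (False \<or> (\<exists>R M. c' = (off + 4 + length ?is, R, M) \<and>
           rep n (env @ [x]) (s (Suc x)) R M \<and> True))"
      by (auto simp: l_def)
  qed (use For.prems in \<open>auto simp: s_def\<close>)
  moreover have "off + length (com_code ?d off (For c)) = off + 7 + l"
    by (simp add: Let_def l_def)
  moreover have "poly (com_cost (For c)) n = n * (poly (com_cost c) n + 5) + 4" by simp
  moreover have "sem n env (For c) st = s n" by (simp add: s_def)
  ultimately show ?case by metis
qed

text \<open>Finds \<open>n\<close> from \<open>n * n\<close> by adding up odd numbers.\<close>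

definition prelude :: "instr list" where
  "prelude = [Imm 2 1, Sub 5 0 4, Jump_Zero 5 8, Add 4 4 1, Add 4 4 1, Add 4 4 2, Add 1 1 2,
     Jump_Zero 3 1]"

text \<open>Acceptance is read from register 0; as register 3 is 0, the final
  \<open>Add 0 5 3\<close> copies the truth value there. The offset 8 is the length of
  \<open>prelude\<close>.\<close>

definition program :: "com \<Rightarrow> fm \<Rightarrow> instr list" where
  "program c \<phi> = prelude @ com_code 0 8 c @
     fm_code 0 (8 + length (com_code 0 8 c)) \<phi> @ [Add 0 5 3]"

lemma length_prelude [simp]: "length prelude = 8"
  by (simp add: prelude_def)

lemma prelude_runs:
  assumes "code_at P 0 prelude" "R 0 = n * n" "\<And>i. i \<noteq> 0 \<Longrightarrow> R i = 0"
  shows "\<exists>R'. runs P (7 * n + 3) (0, R, M) (8, R', M) \<and>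
    R' 0 = n * n \<and> R' 1 = n \<and> R' 2 = 1 \<and> R' 3 = 0"
proof -
  have at: "7 < length P" "P ! 0 = Imm 2 1" "P ! 1 = Sub 5 0 4" "P ! 2 = Jump_Zero 5 8"
    "P ! 3 = Add 4 4 1" "P ! 4 = Add 4 4 1" "P ! 5 = Add 4 4 2" "P ! 6 = Add 1 1 2"
    "P ! 7 = Jump_Zero 3 1"
    using assms(1) by (simp_all add: prelude_def numeral_eq_Suc)
  \<comment> \<open>Register 1 holds \<open>x\<close> and register 4 holds \<open>x * x\<close>. A
    round of 7 instructions adds \<open>x + x + 1\<close> to the latter, until
    \<open>n * n - x * x\<close> vanishes at \<open>x = n\<close>.\<close>
  have loop: "\<exists>R'. runs P (7 * m + 2) (1, R, M) (8, R', M) \<and>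
    R' 0 = n * n \<and> R' 1 = n \<and> R' 2 = 1 \<and> R' 3 = 0"
    if "x + m = n" "R 0 = n * n" "R 1 = x" "R 2 = 1" "R 3 = 0" "R 4 = x * x" for x m R
    using that
  proof (induction m arbitrary: x R)
    case 0
    have "runs P (Suc (Suc 0)) (1, R, M) (8, R(5 := 0), M)"
      using at 0 by (auto intro!: runs_step simp: numeral_eq_Suc)
    then have "runs P (7 * 0 + 2) (1, R, M) (8, R(5 := 0), M)"
      by (simp only: mult_zero_right add_0 numeral_2_eq_2)
    moreover have "(R(5 := 0)) 0 = n * n" "(R(5 := 0)) 1 = n" "(R(5 := 0)) 2 = 1" "(R(5 := 0)) 3 = 0"
      using 0 by simp_all
    ultimately show ?case by blast
  next
    case (Suc m)
    have lt: "n * n - x * x \<noteq> 0"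
      using Suc.prems(1) by (auto simp: algebra_simps)
    let ?R = "R(5 := n * n - x * x, 4 := x * x + x, 4 := x * x + x + x, 4 := x * x + x + x + 1, 1 := x + 1)"
    have *: "runs P (Suc (Suc (Suc (Suc (Suc (Suc (Suc 0))))))) (1, R, M) (1, ?R, M)"
      using at lt Suc.prems by (auto intro!: runs_step simp: numeral_eq_Suc)
    have R: "Suc x + m = n" "?R 0 = n * n" "?R 1 = Suc x" "?R 2 = 1" "?R 3 = 0" "?R 4 = Suc x * Suc x"
      using Suc.prems by simp_all
    obtain R' where R': "runs P (7 * m + 2) (1, ?R, M) (8, R', M)"
      "R' 0 = n * n" "R' 1 = n" "R' 2 = 1" "R' 3 = 0"
      using Suc.IH[OF R] by blast
    have "runs P (7 * Suc m + 2) (1, R, M) (8, R', M)"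
      by (rule runs_trans[OF * R'(1)]) simp
    with R' show ?case by blast
  qed
  have *: "runs P 1 (0, R, M) (1, R(2 := 1), M)"
    unfolding One_nat_def using at by (intro runs_step) auto
  obtain R' where R': "runs P (7 * n + 2) (1, R(2 := 1), M) (8, R', M)"
      "R' 0 = n * n" "R' 1 = n" "R' 2 = 1" "R' 3 = 0"
    using loop[of 0 n "R(2 := 1)"] assms by auto
  have "runs P (7 * n + 3) (0, R, M) (8, R', M)"
    by (rule runs_trans[OF * R'(1)]) simp
  with R' show ?thesis by blast
qed

lemma poly_mono_nat: "x \<le> y \<Longrightarrow> poly p x \<le> poly p y" for p :: "nat poly"
  by (induction p) (auto intro: add_mono mult_mono)

text \<open>The running time is polynomial in \<open>n\<close>, hence also in the length
  \<open>n * n\<close>. The input fills exactly block 0 of the memory and all later cells are 0, so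
  relation 0 is the input matrix and the other relations start empty.\<close>

lemma program_decides:
  assumes "com_wf 0 c" "fm_wf 0 \<phi>"
  shows "\<exists>p :: nat poly. \<forall>n w. length w = n * n \<longrightarrow>
    (\<exists>t \<le> poly p (length w). let c' = (step (program c \<phi>) ^^ t) (init w) in
       halted (program c \<phi>) c' \<and>
       (accepting c' \<longleftrightarrow> eval n [] (sem n [] c
          (\<lambda>k. if k = 0 then {(u, v). u < n \<and> v < n \<and> w ! (u * n + v)} else {})) \<phi>))"
proof -
  \<comment> \<open>The linear polynomial pays for the prelude with \<open>7 * n + 3\<close> steps
    and for the final copy with 1.\<close>
  define p where "p = [:4, 7:] + com_cost c + fm_cost \<phi>"
  have "\<exists>t \<le> poly p (length w). let c' = (step (program c \<phi>) ^^ t) (init w) in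
       halted (program c \<phi>) c' \<and> (accepting c' \<longleftrightarrow> eval n [] (sem n [] c st) \<phi>)"
    if w: "length w = n * n"
      and st: "st = (\<lambda>k. if k = 0 then {(u, v). u < n \<and> v < n \<and> w ! (u * n + v)} else {})"
    for n w st
  proof -
    define P where "P = program c \<phi>"
    let ?R = "(\<lambda>_. 0)(0 := length w) :: nat \<Rightarrow> nat"
    let ?M = "\<lambda>a. if a < length w \<and> w ! a then 1 else 0 :: nat"
    define l where "l = length (com_code 0 8 c)"
    define l' where "l' = length (fm_code 0 (8 + l) \<phi>)"
    have P: "P = prelude @ com_code 0 8 c @ fm_code 0 (8 + l) \<phi> @ [Add 0 5 3]"
      by (simp add: P_def program_def l_def)
    have "code_at P 0 Q" if "P = Q" for Q
      using that code_at_self[of "[]" P] by simp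
    from this[OF P] have code: "code_at P 0 prelude" "code_at P 8 (com_code 0 8 c)"
      "code_at P (8 + l) (fm_code 0 (8 + l) \<phi>)" "8 + l + l' < length P"
      "P ! (8 + l + l') = Add 0 5 3"
      by (simp_all add: l_def l'_def add_ac)
    have len: "length P = 8 + l + l' + 1"
      by (simp add: P l_def l'_def)
    obtain R where R: "runs P (7 * n + 3) (0, ?R, ?M) (8, R, ?M)"
      "R 0 = n * n" "R 1 = n" "R 2 = 1" "R 3 = 0"
      using prelude_runs[OF code(1), of ?R n ?M] w by auto
    have "u * n + v < n * n" if "u < n" "v < n" for u v
    proof -
      have "u * n + v < Suc u * n" using that by simp
      also have "\<dots> \<le> n * n" using that by (intro mult_le_mono1) simp
      finally show ?thesis .
    qed
    moreover have "\<not> u * n + v + k * (n * n) < n * n" if "k \<noteq> 0" for u v k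
      using that by (cases k) auto
    ultimately have "rep n [] st R ?M"
      using R w by (simp add: rep_def st)
    then obtain R1 M1 where 1: "runs P (poly (com_cost c) n) (8, R, ?M) (8 + l, R1, M1)"
      "rep n [] (sem n [] c st) R1 M1"
      using com_code_runs[of "[]" c n st R ?M P 8] assms code by (auto simp: l_def)
    obtain R2 where 2: "runs P (poly (fm_cost \<phi>) n) (8 + l, R1, M1) (8 + l + l', R2, M1)"
      "rep n [] (sem n [] c st) R2 M1" "R2 5 \<noteq> 0 \<longleftrightarrow> eval n [] (sem n [] c st) \<phi>"
      using fm_code_runs[of "[]" \<phi> n "sem n [] c st" R1 M1 P "8 + l"] 1 assms code by (auto simp: l'_def)
    have "R2 3 = 0" using 2(2) by (simp add: rep_def)
    then have 3: "runs P 1 (8 + l + l', R2, M1) (length P, R2(0 := R2 5), M1)"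
      unfolding One_nat_def len using code by (intro runs_step) auto
    have "runs P (poly p n) (init w) (length P, R2(0 := R2 5), M1)"
      unfolding init_def
      by (rule runs_trans[OF runs_trans[OF runs_trans[OF R(1) 1(1), OF order_refl] 2(1), OF order_refl] 3])
        (simp add: p_def)
    then obtain t where "t \<le> poly p n" "(step P ^^ t) (init w) = (length P, R2(0 := R2 5), M1)"
      unfolding runs_def by blast
    moreover have "poly p n \<le> poly p (length w)"
      unfolding w by (rule poly_mono_nat) simp
    ultimately show ?thesis using 2(3)
      by (intro exI[of _ t]) (simp add: P_def[symmetric] Let_def halted_def accepting_def)
  qed
  then show ?thesis by blast
qed

section \<open>Derived connectives and assignment to a whole relation\<close>

abbreviation Disj :: "fm \<Rightarrow> fm \<Rightarrow> fm" where
  "Disj \<phi> \<psi> \<equiv> Neg (Conj (Neg \<phi>) (Neg \<psi>))"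

abbreviation Exists :: "fm \<Rightarrow> fm" where
  "Exists \<phi> \<equiv> Neg (Forall (Neg \<phi>))"

definition Equal :: "nat \<Rightarrow> nat \<Rightarrow> fm" where
  "Equal i j = Conj (Neg (Less i j)) (Neg (Less j i))"

lemma eval_Equal [simp]: "eval n env st (Equal i j) \<longleftrightarrow> env ! i = env ! j"
  by (auto simp: Equal_def)

lemma fm_wf_Equal [simp]: "fm_wf d (Equal i j) \<longleftrightarrow> i < d \<and> j < d"
  by (auto simp: Equal_def)

text \<open>Relation 1 serves as a buffer, so that \<open>\<phi>\<close> may mention the relation assigned to.\<close>

definition Assign :: "nat \<Rightarrow> nat \<Rightarrow> fm \<Rightarrow> com" where
  "Assign d k \<phi> = Seq (For (For (Put 1 d (Suc d) \<phi>))) (For (For (Put k d (Suc d) (Rel 1 d (Suc d)))))"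

lemma fold_upt_Suc: "fold f [0..<Suc m] s = f m (fold f [0..<m] s)"
  by simp

lemma sem_For: "sem n env (For c) = fold (\<lambda>x. sem n (env @ [x]) c) [0..<n]"
  by (rule ext) simp

text \<open>The value of the formula is independent of relation \<open>k\<close>, so updates of
  single pairs do not disturb each other.\<close>

lemma sem_for_put:
  assumes indep: "\<And>a b X. a < n \<Longrightarrow> b < n \<Longrightarrow>
      eval n (env @ [a, b]) (st(k := X)) \<phi> = eval n (env @ [a, b]) st \<phi>"
    and n: "0 < n" and d: "d = length env"
  shows "sem n env (For (For (Put k d (Suc d) \<phi>))) st =
    st(k := {(a, b). a < n \<and> b < n \<and> eval n (env @ [a, b]) st \<phi>})"
proof -
  let ?D = "{..<n} \<times> {..<n}"
  define Q where "Q = {(a, b). a < n \<and> b < n \<and> eval n (env @ [a, b]) st \<phi>}"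
  \<comment> \<open>The case \<open>m = 0\<close> is separate because truncation to
    \<open>?D\<close> happens only with the first update.\<close>
  define F where "F a m X = (if m = 0 then X else (X \<inter> ?D - {a} \<times> {..<m}) \<union> (Q \<inter> {a} \<times> {..<m}))"
    for a m :: nat and X
  have inner: "fold (\<lambda>b. sem n (env @ [a, b]) (Put k d (Suc d) \<phi>)) [0..<m] (st(k := X)) =
      st(k := F a m X)" if "a < n" "m \<le> n" for a X m
    using that(2)
  proof (induction m)
    case (Suc m)
    have F: "(if (a, m) \<in> Q then insert (a, m) else (\<lambda>X. X - {(a, m)})) (F a m X \<inter> ?D) = F a (Suc m) X"
      using Suc.prems \<open>a < n\<close> by (auto simp: F_def less_Suc_eq)
    have "eval n (env @ [a, m]) (st(k := Y)) \<phi> \<longleftrightarrow> (a, m) \<in> Q" for Y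
      using indep[of a m] Suc.prems \<open>a < n\<close> by (simp add: Q_def)
    then have "sem n (env @ [a, m]) (Put k d (Suc d) \<phi>) (st(k := F a m X)) = st(k := F a (Suc m) X)"
      by (simp only: sem.simps F[symmetric] fun_upd_same fun_upd_upd) (simp add: d nth_append)
    with Suc show ?case unfolding fold_upt_Suc by (metis Suc_leD)
  qed (simp add: F_def)
  define G where "G m = (if m = 0 then st k else (st k \<inter> ?D - {..<m} \<times> {..<n}) \<union> (Q \<inter> {..<m} \<times> {..<n}))"
    for m :: nat
  have outer: "fold (\<lambda>a st. fold (\<lambda>b. sem n (env @ [a, b]) (Put k d (Suc d) \<phi>)) [0..<n] st) [0..<m] st =
      st(k := G m)" if "m \<le> n" for m
    using that
  proof (induction m)
    case (Suc m)
    have "F m n (G m) = G (Suc m)"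
      using n Suc.prems by (auto simp: F_def G_def less_Suc_eq)
    with inner[of m n "G m"] Suc show ?case unfolding fold_upt_Suc by (metis Suc_le_lessD Suc_leD order_refl)
  qed (simp add: G_def)
  have "G n = Q" using n by (auto simp: G_def Q_def)
  with outer[of n] show ?thesis by (simp del: sem.simps add: sem_For Q_def)
qed

lemma sem_Assign:
  fixes env :: "nat list"
  assumes indep: "\<And>a b X. a < n \<Longrightarrow> b < n \<Longrightarrow>
      eval n (env @ [a, b]) (st(1 := X)) \<phi> = eval n (env @ [a, b]) st \<phi>"
    and n: "0 < n" and d: "d = length env" and k: "k \<noteq> 1"
  defines "Q \<equiv> {(a, b). a < n \<and> b < n \<and> eval n (env @ [a, b]) st \<phi>}"
  shows "sem n env (Assign d k \<phi>) st = st(1 := Q, k := Q)"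
proof -
  have "sem n env (Assign d k \<phi>) st =
      sem n env (For (For (Put k d (Suc d) (Rel 1 d (Suc d))))) (st(1 := Q))"
    unfolding Assign_def sem.simps(2) Q_def
    by (subst sem_for_put[OF indep n d]) auto
  also have "\<dots> = st(1 := Q, k := {(a, b). a < n \<and> b < n \<and>
      eval n (env @ [a, b]) (st(1 := Q)) (Rel 1 d (Suc d))})"
    using k n d by (subst sem_for_put) auto
  also have "{(a, b). a < n \<and> b < n \<and> eval n (env @ [a, b]) (st(1 := Q)) (Rel 1 d (Suc d))} = Q"
    by (auto simp: d nth_append Q_def)
  finally show ?thesis .
qed

lemma com_wf_Assign [simp]: "com_wf d (Assign d k \<phi>) \<longleftrightarrow> fm_wf (Suc (Suc d)) \<phi>"
  by (simp add: Assign_def)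

section \<open>Disjoint spanning sets of two matroids\<close>

locale matroid_closure =
  fixes cl :: "'e set \<Rightarrow> 'e set"
  assumes extensive: "X \<subseteq> cl X"
    and closed: "X \<subseteq> cl Y \<Longrightarrow> cl X \<subseteq> cl Y"
    and exchange: "y \<in> cl (insert x X) \<Longrightarrow> y \<notin> cl X \<Longrightarrow> x \<in> cl (insert y X)"
begin

lemma mono: "X \<subseteq> Y \<Longrightarrow> cl X \<subseteq> cl Y"
  using closed extensive by (meson subset_trans)

definition indep :: "'e set \<Rightarrow> bool" where
  "indep I \<longleftrightarrow> (\<forall>x\<in>I. x \<notin> cl (I - {x}))"

lemma indep_subset: "indep I \<Longrightarrow> J \<subseteq> I \<Longrightarrow> indep J"
  unfolding indep_def using mono by (meson Diff_mono subsetD subset_refl)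

lemma indep_insert:
  assumes "indep I" "e \<notin> cl I"
  shows "indep (insert e I)"
proof -
  have "e \<notin> I" using assms extensive by blast
  have "x \<notin> cl (insert e (I - {x}))" if "x \<in> I" for x
  proof
    assume "x \<in> cl (insert e (I - {x}))"
    moreover have "x \<notin> cl (I - {x})" using assms(1) that by (simp add: indep_def)
    ultimately have "e \<in> cl (insert x (I - {x}))" by (rule exchange)
    with that assms(2) show False by (simp add: insert_absorb)
  qed
  moreover have "insert e I - {x} = insert e (I - {x})" if "x \<in> I" for x
    using that \<open>e \<notin> I\<close> by auto
  ultimately show ?thesis
    using assms(2) \<open>e \<notin> I\<close> by (auto simp: indep_def)
qed

text \<open>Steinitz exchange: an element of \<open>I - J\<close> is traded for an element of
  \<open>J\<close> that the rest of \<open>I\<close> does not span. This keeps independence and size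
  and lowers \<open>card (I - J)\<close>.\<close>

lemma card_indep_le:
  assumes "finite I" "finite J" "indep I" "I \<subseteq> cl J"
  shows "card I \<le> card J"
  using assms
proof (induction "card (I - J)" arbitrary: I rule: less_induct)
  case less
  show ?case
  proof (cases "I \<subseteq> J")
    case True
    then show ?thesis using less.prems by (simp add: card_mono)
  next
    case False
    then obtain x where x: "x \<in> I" "x \<notin> J" by blast
    then have "x \<notin> cl (I - {x})" using less.prems by (simp add: indep_def)
    \<comment> \<open>Otherwise \<open>I - {x}\<close> would span \<open>J\<close>, and with it
      \<open>x\<close>.\<close>
    then have "\<not> J \<subseteq> cl (I - {x})" using closed less.prems x by blast
    then obtain y where y: "y \<in> J" "y \<notin> cl (I - {x})" by blast
    then have y': "y \<notin> I - {x}" using extensive[of "I - {x}"] by blast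
    let ?I = "insert y (I - {x})"
    have "card (?I - J) < card (I - J)"
      using less.prems x y by (intro psubset_card_mono) auto
    moreover have "indep ?I"
      using indep_insert[OF indep_subset[OF less.prems(3)] y(2)] by blast
    moreover have "?I \<subseteq> cl J" using less.prems y extensive by blast
    ultimately have "card ?I \<le> card J" using less.hyps less.prems by simp
    moreover have "card ?I = card I"
      using less.prems x y' by (metis card_Suc_Diff1 card_insert_disjoint finite_Diff)
    ultimately show ?thesis by simp
  qed
qed

lemma ex_basis: "finite X \<Longrightarrow> \<exists>B\<subseteq>X. indep B \<and> X \<subseteq> cl B"
proof (induction rule: finite_induct)
  case (insert x X)
  then obtain B where B: "B \<subseteq> X" "indep B" "X \<subseteq> cl B" by blast
  show ?case
  proof (cases "x \<in> cl B")
    case True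
    with B show ?thesis by blast
  next
    case False
    have "insert x X \<subseteq> cl (insert x B)"
      using B extensive[of "insert x B"] mono[of B "insert x B"] by blast
    with B False indep_insert show ?thesis by (intro exI[of _ "insert x B"]) blast
  qed
qed (auto simp: indep_def)

text \<open>The \<open>x \<in> I\<close> with \<open>e \<notin> cl (I - {x})\<close> form the circuit that \<open>e\<close> closes with \<open>I\<close>.\<close>

lemma ex_circuit_member:
  assumes "indep I" "finite I" "J \<subseteq> I" "e \<in> cl I" "e \<notin> cl J"
  obtains x where "x \<in> I - J" "e \<notin> cl (I - {x})"
proof -
  \<comment> \<open>If no element of \<open>I - J\<close> were on the circuit, they could be
    discarded one at a time with \<open>e\<close> still spanned, down to \<open>J\<close>. A discard
    of \<open>x\<close> that loses \<open>e\<close> would by exchange put \<open>x\<close> into the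
    span of \<open>I - {x}\<close>.\<close>
  have "e \<in> cl (I - R)" if R: "R \<subseteq> I - J" and all: "\<forall>x\<in>I - J. e \<in> cl (I - {x})" for R
    using finite_subset[OF R finite_Diff[OF assms(2)]] R
  proof (induction rule: finite_induct)
    case (insert x R)
    have "e \<in> cl (I - R - {x})"
    proof (rule ccontr)
      assume "e \<notin> cl (I - R - {x})"
      moreover have "e \<in> cl (insert x (I - R - {x}))"
        using insert by (simp add: insert_absorb)
      ultimately have "x \<in> cl (insert e (I - R - {x}))" by (rule exchange[rotated])
      moreover have "insert e (I - R - {x}) \<subseteq> cl (I - {x})"
        using all insert extensive[of "I - {x}"] by blast
      ultimately have "x \<in> cl (I - {x})" using closed by blast
      with assms insert show False by (auto simp: indep_def)
    qed
    moreover have "I - R - {x} = I - insert x R" by blast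
    ultimately show ?case by simp
  qed (use assms in auto)
  from this[of "I - J"] assms that show thesis
    by (metis Diff_Diff_Int finite_Diff inf.absorb2 order_refl)
qed

lemma span_swap:
  assumes "x \<in> K" "e \<in> cl K" "e \<notin> cl (K - {x})"
  shows "cl (insert e (K - {x})) = cl K"
proof
  show "cl (insert e (K - {x})) \<subseteq> cl K"
    using assms extensive[of K] by (intro closed) blast
  have "x \<in> cl (insert e (K - {x}))"
    using assms exchange[of e x "K - {x}"] by (simp add: insert_absorb)
  then show "cl K \<subseteq> cl (insert e (K - {x}))"
    using extensive[of "insert e (K - {x})"] by (intro closed) blast
qed

end

text \<open>The choice is returned as a set, empty or a singleton, so that a relation of a program
  can hold it and the absence of a choice needs no separate treatment.\<close>

locale matroid_pair =
  fixes cl :: "bool \<Rightarrow> 'e set \<Rightarrow> 'e set" and A :: "'e set" and pick :: "'e set \<Rightarrow> 'e set"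
  assumes matroid: "matroid_closure (cl j)"
    and finite_A: "finite A"
    and pick_empty [simp]: "pick {} = {}"
    and pick: "finite X \<Longrightarrow> X \<noteq> {} \<Longrightarrow> \<exists>x\<in>X. pick X = {x}"
begin

lemma pick_subset: "finite X \<Longrightarrow> pick X \<subseteq> X"
  using pick[of X] by (cases "X = {}") auto

definition indep :: "bool \<Rightarrow> 'e set \<Rightarrow> bool" where
  "indep j = matroid_closure.indep (cl j)"

definition valid :: "(bool \<Rightarrow> 'e set) \<Rightarrow> bool" where
  "valid I \<longleftrightarrow> (\<forall>j. I j \<subseteq> A \<and> indep j (I j)) \<and> I False \<inter> I True = {}"

definition uncovered :: "(bool \<Rightarrow> 'e set) \<Rightarrow> 'e set" where
  "uncovered I = A - (I False \<union> I True)"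

text \<open>
  Inside \<open>S\<close>, a basis in \<open>B j\<close> is no larger than \<open>I j\<close>, which spans \<open>S\<close>; outside \<open>S\<close>, the
  sets \<open>I j\<close> cover everything.
\<close>

lemma covering_optimal:
  assumes I: "valid I" and S: "S \<subseteq> A" "uncovered I \<subseteq> S" "\<And>j. S \<subseteq> cl j (I j \<inter> S)"
    and B: "\<And>j. B j \<subseteq> A" "B False \<inter> B True = {}" "\<And>j. A \<subseteq> cl j (B j)"
  shows "A \<subseteq> cl j (I j)"
proof -
  interpret M: matroid_closure "cl i" for i by (rule matroid)
  have fin: "finite X" if "X \<subseteq> A" for X using that finite_A by (rule finite_subset)
  have "\<exists>C \<subseteq> B j. M.indep j C \<and> B j \<subseteq> cl j C" for j
    using M.ex_basis[OF fin[OF B(1)]] by blast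
  then obtain C where C: "\<And>j. C j \<subseteq> B j" "\<And>j. M.indep j (C j)" "\<And>j. B j \<subseteq> cl j (C j)"
    by metis
  have CA: "C j \<subseteq> A" "A \<subseteq> cl j (C j)" for j
    using B C M.closed by (blast, meson subset_trans)
  have IA: "I j \<subseteq> A" "M.indep j (I j)" for j
    using I by (auto simp: valid_def indep_def)
  note fins = fin[OF CA(1)] fin[OF IA(1)] fin[OF S(1)]
  have "card (C j \<inter> S) \<le> card (I j \<inter> S)" for j
    using S(3)[of j] C(2)[of j] fins by (intro M.card_indep_le) (auto intro: M.indep_subset)
  then have 1: "card (C False \<inter> S) + card (C True \<inter> S) \<le> card (I False \<inter> S) + card (I True \<inter> S)"
    by (intro add_mono)
  have "card (C False - S) + card (C True - S) = card ((C False \<union> C True) - S)"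
    using B(2) C(1) fins
    by (subst card_Un_disjoint[symmetric]) (auto intro!: arg_cong[of _ _ card])
  also have "\<dots> \<le> card ((I False \<union> I True) - S)"
    using S(2) CA(1) fins by (intro card_mono) (auto simp: uncovered_def)
  also have "\<dots> = card (I False - S) + card (I True - S)"
    using I fins
    by (subst card_Un_disjoint[symmetric]) (auto intro!: arg_cong[of _ _ card] simp: valid_def)
  finally have 2: "card (C False - S) + card (C True - S) \<le> card (I False - S) + card (I True - S)" .
  have split: "card (X \<inter> S) + card (X - S) = card X" if "finite X" for X
    using card_Int_Diff[OF that, of S] by simp
  have sum: "card (C False) + card (C True) \<le> card (I False) + card (I True)"
    using 1 2 split[OF fins(1)] split[OF fins(2)] by (smt (verit, del_insts) add.assoc add.commute add_mono)
  have le: "card X \<le> card (C j)" if "X \<subseteq> A" "M.indep j X" for X j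
    using that CA(2)[of j] fins fin by (intro M.card_indep_le) auto
  \<comment> \<open>\<open>C j\<close> spans \<open>A\<close>, so \<open>I j\<close> is at most as
    large; the inequality of the sums then forces equality. An element outside the span of
    \<open>I j\<close> would yield an independent set larger than \<open>C j\<close>.\<close>
  have eq: "card (I j) = card (C j)"
    using sum le[OF IA, of False] le[OF IA, of True] by (cases j) auto
  have "e \<in> cl j (I j)" if e: "e \<in> A" for e
  proof (rule ccontr)
    assume "e \<notin> cl j (I j)"
    moreover from this have "e \<notin> I j" using M.extensive by blast
    ultimately have "card (insert e (I j)) \<le> card (C j)" "card (insert e (I j)) = Suc (card (I j))"
      using e IA fins le[of "insert e (I j)" j] M.indep_insert[of j "I j" e] by auto
    with eq show False by simp
  qed
  then show ?thesis by blast
qed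

section \<open>Stages, augmentation steps and their termination\<close>

definition shrink :: "(bool \<Rightarrow> 'e set) \<Rightarrow> 'e set \<Rightarrow> 'e set" where
  "shrink I S = S \<inter> cl False (I False \<inter> S) \<inter> cl True (I True \<inter> S)"

abbreviation stage :: "(bool \<Rightarrow> 'e set) \<Rightarrow> nat \<Rightarrow> 'e set" where
  "stage I i \<equiv> (shrink I ^^ i) A"

lemma shrink_iff: "x \<in> shrink I S \<longleftrightarrow> x \<in> S \<and> (\<forall>j. x \<in> cl j (I j \<inter> S))"
  by (auto simp: shrink_def) (metis (full_types))

lemma stage_antimono: "i \<le> k \<Longrightarrow> stage I k \<subseteq> stage I i"
  by (rule lift_Suc_antimono_le) (auto simp: shrink_def)

lemma stage_subset: "stage I i \<subseteq> A"
  using stage_antimono[of 0 i I] by simp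

text \<open>The first matroid has priority, so at most one element enters per step and the two sets
  stay disjoint.\<close>

definition cand :: "(bool \<Rightarrow> 'e set) \<Rightarrow> 'e set \<Rightarrow> bool \<Rightarrow> 'e set" where
  "cand I S j = (if j \<and> uncovered I - cl False (I False \<inter> S) \<noteq> {} then {} else uncovered I - cl j (I j \<inter> S))"

definition enter :: "(bool \<Rightarrow> 'e set) \<Rightarrow> 'e set \<Rightarrow> bool \<Rightarrow> 'e set" where
  "enter I S j = pick (cand I S j)"

definition leave :: "(bool \<Rightarrow> 'e set) \<Rightarrow> 'e set \<Rightarrow> bool \<Rightarrow> 'e set" where
  "leave I S j = pick {x \<in> I j - S. \<exists>e\<in>enter I S j. e \<notin> cl j (I j - {x})}"

text \<open>An exchange changes the stages, so afterwards the descent starts again from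
  \<open>A\<close>.\<close>

definition improve :: "(bool \<Rightarrow> 'e set) \<times> 'e set \<Rightarrow> (bool \<Rightarrow> 'e set) \<times> 'e set" where
  "improve = (\<lambda>(I, S). (\<lambda>j. (I j \<union> enter I S j) - leave I S j,
     if cand I S False = {} \<and> cand I S True = {} then shrink I S else A))"

definition reached :: "(bool \<Rightarrow> 'e set) \<times> 'e set \<Rightarrow> bool" where
  "reached = (\<lambda>(I, S). valid I \<and> (\<exists>i. S = stage I i \<and> uncovered I \<subseteq> S))"

lemma valid_reached: "valid I \<Longrightarrow> reached (I, A)"
proof -
  assume "valid I"
  moreover have "A = stage I 0" "uncovered I \<subseteq> A" by (auto simp: uncovered_def)
  ultimately show ?thesis unfolding reached_def by blast
qed

text \<open>The stages decrease, so this is the smallest of them that contains the uncovered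
  elements; the intersection avoids choosing its index.\<close>

definition core :: "(bool \<Rightarrow> 'e set) \<Rightarrow> 'e set" where
  "core I = \<Inter> {stage I i |i. uncovered I \<subseteq> stage I i}"

text \<open>
  Encodes the lexicographic order on the number of uncovered elements, the codimension of the
  last stage that contains them all, and the size of \<open>S\<close>.
\<close>

definition potential :: "(bool \<Rightarrow> 'e set) \<times> 'e set \<Rightarrow> nat" where
  "potential = (\<lambda>(I, S). (card (uncovered I) * Suc (card A) + (card A - card (core I))) * Suc (card A) + card S)"

lemma core_subset: "core I \<subseteq> A"
proof -
  have "uncovered I \<subseteq> stage I 0" by (auto simp: uncovered_def)
  then have "core I \<subseteq> stage I 0" unfolding core_def by (intro Inter_lower) blast
  then show ?thesis by simp
qed

lemma enter_cases:
  obtains (none) "cand I S False = {}" "cand I S True = {}" "enter I S = (\<lambda>_. {})" "leave I S = (\<lambda>_. {})"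
  | (one) k e where "cand I S False \<noteq> {} \<or> cand I S True \<noteq> {}"
    "enter I S k = {e}" "enter I S (\<not> k) = {}" "leave I S (\<not> k) = {}"
    "leave I S k = pick {x \<in> I k - S. e \<notin> cl k (I k - {x})}" "e \<in> uncovered I" "e \<notin> cl k (I k \<inter> S)"
proof (cases "cand I S False = {} \<and> cand I S True = {}")
  case True
  then have "enter I S j = {}" "leave I S j = {}" for j
    by (cases j; simp add: enter_def leave_def)+
  with True none show ?thesis by blast
next
  case False
  define k where "k \<longleftrightarrow> cand I S False = {}"
  from False have ne: "cand I S k \<noteq> {}" by (cases k) (auto simp: k_def)
  have "cand I S (\<not> k) = {}" by (cases k) (auto simp: k_def cand_def)
  then have not_k: "enter I S (\<not> k) = {}" "leave I S (\<not> k) = {}" by (simp_all add: enter_def leave_def)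
  have "finite (cand I S k)"
    using finite_A by (auto simp: cand_def uncovered_def)
  with ne pick obtain e where e: "e \<in> cand I S k" "enter I S k = {e}"
    unfolding enter_def by blast
  then have "e \<in> uncovered I" "e \<notin> cl k (I k \<inter> S)"
    by (auto simp: cand_def split: if_splits)
  with e not_k False show ?thesis by (intro one[of k e]) (auto simp: leave_def)
qed

text \<open>
  Moving \<open>e\<close>, which first drops out at stage \<open>Suc i\<close>, into the place of an \<open>x\<close> on its circuit
  leaves the spans that define stages up to \<open>i\<close> unchanged, and \<open>x\<close> drops out one stage earlier.
\<close>

lemma stage_swap:
  assumes I: "valid I" and e: "e \<in> stage I i"
    and x: "x \<in> I k - stage I i" "e \<notin> cl k (I k - {x})"
    and I': "I' = I(k := insert e (I k - {x}))" and m: "m \<le> i"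
  shows "stage I' m = stage I m"
  using m
proof (induction m)
  case (Suc m)
  interpret M: matroid_closure "cl i" for i by (rule matroid)
  let ?S = "stage I m"
  have "e \<in> stage I (Suc m)" using e stage_antimono[OF Suc.prems] by blast
  then have e': "e \<in> ?S" "e \<in> cl k (I k \<inter> ?S)" by (auto simp: shrink_iff)
  \<comment> \<open>Otherwise \<open>I k \<inter> ?S\<close> would span \<open>e\<close> without
    \<open>x\<close>, against the choice of \<open>x\<close>.\<close>
  have "x \<in> ?S"
  proof (rule ccontr)
    assume "x \<notin> ?S"
    then have "cl k (I k \<inter> ?S) \<subseteq> cl k (I k - {x})" by (intro M.mono) auto
    with e' x show False by blast
  qed
  moreover have "e \<notin> cl k (I k \<inter> ?S - {x})"
    using x(2) M.mono[of "I k \<inter> ?S - {x}" "I k - {x}" k] by blast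
  ultimately have "cl k (insert e (I k \<inter> ?S - {x})) = cl k (I k \<inter> ?S)"
    using e' x by (intro M.span_swap) auto
  moreover have "I' k \<inter> ?S = insert e (I k \<inter> ?S - {x})"
    using e' I' by auto
  ultimately have "cl j (I' j \<inter> ?S) = cl j (I j \<inter> ?S)" for j
    using I' by (cases "j = k") auto
  then have "shrink I' ?S = shrink I ?S" by (simp add: shrink_def)
  with Suc show ?case by simp
qed simp

lemma potential_less:
  assumes "card (uncovered I') < card (uncovered I) \<or>
      card (uncovered I') = card (uncovered I) \<and>
        (card (core I) < card (core I') \<or> core I = core I' \<and> card S' < card S)"
    and S: "S' \<subseteq> A"
  shows "potential (I', S') < potential (I, S)"
proof -
  let ?N = "Suc (card A)"
  let ?b = "\<lambda>I. card A - card (core I)"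
  have b: "?b I' < ?N" for I' by simp
  have S': "card S' < ?N" using S finite_A by (simp add: card_mono less_Suc_eq_le)
  \<comment> \<open>The lower terms are digits in base \<open>card A + 1\<close>, so a smaller
    leading part outweighs them.\<close>
  have step: "a' * ?N + b' < a * ?N + b" if "a' < a" "b' < ?N" for a a' b b'
  proof -
    have "a' * ?N + b' < Suc a' * ?N" using that by simp
    also have "\<dots> \<le> a * ?N" using that by (intro mult_le_mono1) simp
    finally show ?thesis by simp
  qed
  have core: "card (core I) \<le> card A" for I
    using core_subset finite_A by (simp add: card_mono)
  from assms(1) show ?thesis
  proof (elim disjE conjE)
    assume "card (uncovered I') < card (uncovered I)"
    then show ?thesis unfolding potential_def prod.case by (intro step S' b)
  next
    assume "card (uncovered I') = card (uncovered I)" "card (core I) < card (core I')"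
    with core[of I'] have "card (uncovered I') * ?N + ?b I' < card (uncovered I) * ?N + ?b I" by simp
    from step[OF this S'] show ?thesis unfolding potential_def prod.case .
  qed (simp add: potential_def)
qed

lemma improve_step:
  assumes "reached c"
  shows "reached (improve c)" "improve c \<noteq> c \<Longrightarrow> potential (improve c) < potential c"
proof -
  interpret M: matroid_closure "cl i" for i by (rule matroid)
  obtain I S where c: "c = (I, S)" by fastforce
  with assms obtain i where I: "valid I" and S: "S = stage I i" "uncovered I \<subseteq> S"
    by (auto simp: reached_def)
  have finI: "finite (I j)" for j
    using I finite_A by (auto simp: valid_def intro: finite_subset)
  have finU: "finite (uncovered I)" for I using finite_A by (simp add: uncovered_def)
  have "reached (improve c) \<and> (improve c \<noteq> c \<longrightarrow> potential (improve c) < potential c)"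
  proof (cases rule: enter_cases[of I S])
    case none
    then have imp: "improve c = (I, shrink I S)"
      by (simp add: c improve_def)
    have "uncovered I \<subseteq> cl j (I j \<inter> S)" for j
      using none by (cases j) (auto simp: cand_def split: if_splits)
    then have "uncovered I \<subseteq> shrink I S" using S(2) unfolding subset_iff shrink_iff by blast
    then have "reached (improve c)" using I S by (auto simp: imp reached_def intro!: exI[of _ "Suc i"])
    moreover have "potential (improve c) < potential c" if "improve c \<noteq> c"
    proof -
      have "shrink I S \<subset> S" using that c imp by (auto simp: shrink_def)
      moreover have "S \<subseteq> A" using S stage_subset by blast
      ultimately show ?thesis
        unfolding c imp[unfolded c] using finite_A
        by (intro potential_less) (auto intro!: psubset_card_mono finite_subset[OF \<open>S \<subseteq> A\<close>])
    qed
    ultimately show ?thesis by blast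
  next
    case (one k e)
    define X where "X = leave I S k"
    define I' where "I' = I(k := insert e (I k) - X)"
    have "I j \<union> enter I S j - leave I S j = I' j" for j
    proof (cases "j = k")
      case True
      with one show ?thesis by (simp add: I'_def X_def)
    next
      case False
      then have "j = (\<not> k)" by auto
      with one show ?thesis by (simp add: I'_def)
    qed
    then have imp: "improve c = (I', A)" using one(1) by (auto simp: c improve_def)
    have e: "e \<in> A" "e \<notin> I False" "e \<notin> I True" "e \<in> S"
      using one(6) S by (auto simp: uncovered_def)
    have enI: "e \<notin> I k" using e by (cases k) auto
    show ?thesis
    proof (cases "e \<in> cl k (I k)")
      case False
      \<comment> \<open>At stage 0 the set \<open>I k - S\<close> is empty. A later stage is
        impossible, because its elements are spanned by the part of \<open>I k\<close> in the
        preceding stage.\<close>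
      have "X = {}"
      proof (cases i)
        case 0
        then have "I k - S = {}" using S I by (auto simp: valid_def)
        then have "{x \<in> I k - S. e \<notin> cl k (I k - {x})} = {}" by blast
        then show ?thesis using one(5) by (simp only: X_def pick_empty)
      next
        case (Suc i')
        then have "e \<in> cl k (I k \<inter> stage I i')" using e S by (auto simp: shrink_iff)
        with False M.mono[of "I k \<inter> stage I i'" "I k" k] show ?thesis by blast
      qed
      then have I'_eq: "I' = I(k := insert e (I k))" by (simp add: I'_def)
      have "valid I'"
        unfolding valid_def
      proof (intro conjI allI)
        fix j
        show "I' j \<subseteq> A" using I e by (auto simp: I'_eq valid_def)
        show "indep j (I' j)"
          using I False M.indep_insert[of k "I k" e] by (auto simp: I'_eq valid_def indep_def)
        show "I' False \<inter> I' True = {}"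
          using I e by (cases k) (auto simp: I'_eq valid_def)
      qed
      moreover have U: "uncovered I' = uncovered I - {e}"
        by (cases k) (auto simp: I'_eq uncovered_def)
      ultimately have "reached (improve c)" unfolding imp by (intro valid_reached)
      moreover have "card (uncovered I') < card (uncovered I)"
        unfolding U using one(6) finU by (intro card_Diff1_less)
      then have "potential (improve c) < potential c"
        unfolding imp unfolding c by (intro potential_less) auto
      ultimately show ?thesis by blast
    next
      case True
      let ?Y = "{x \<in> I k - S. e \<notin> cl k (I k - {x})}"
      have "M.indep k (I k)" using I by (simp add: valid_def indep_def)
      then obtain x where "x \<in> I k - (I k \<inter> S)" "e \<notin> cl k (I k - {x})"
        using M.ex_circuit_member[of k "I k" "I k \<inter> S" e] finI one(7) True by blast
      then have "?Y \<noteq> {}" by auto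
      moreover have "finite ?Y" using finI by simp
      ultimately obtain x where x: "x \<in> ?Y" "X = {x}"
        using pick[of ?Y] one(5) by (auto simp: X_def)
      have xe: "x \<noteq> e" using x enI by auto
      have I'_eq: "I' = I(k := insert e (I k - {x}))" using x(2) xe by (simp add: I'_def insert_Diff_if)
      have xA: "x \<in> A" "x \<in> I k" "x \<notin> S" "x \<notin> I (\<not> k)"
        using x I by (cases k; auto simp: valid_def)+
      have "valid I'"
        unfolding valid_def
      proof (intro conjI allI)
        fix j
        show "I' j \<subseteq> A" using I e by (auto simp: I'_eq valid_def)
        show "indep j (I' j)"
          using I x M.indep_insert[of k "I k - {x}" e] M.indep_subset[of k "I k" "I k - {x}"]
          by (auto simp: I'_eq valid_def indep_def)
        show "I' False \<inter> I' True = {}"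
          using I e by (cases k) (auto simp: I'_eq valid_def)
      qed
      then have "reached (improve c)" unfolding imp by (rule valid_reached)
      moreover have U: "uncovered I' = insert x (uncovered I - {e})"
        using xA xe by (cases k) (auto simp: I'_eq uncovered_def)
      have "x \<notin> uncovered I" using xA by (cases k) (auto simp: uncovered_def)
      then have cardU: "card (uncovered I') = card (uncovered I)"
        unfolding U using one(6) finU[of I] by (metis card_Suc_Diff1 card_insert_disjoint finite_Diff DiffD1)
      have same: "stage I' m = stage I m" if "m \<le> i" for m
        using stage_swap[OF I _ _ _ I'_eq that] e x S by auto
      have "core I \<subseteq> S" using S by (auto simp: core_def)
      obtain i' where i': "i = Suc i'" using S xA by (cases i) auto
      have "x \<in> stage I i'"
      proof (rule ccontr)
        assume "x \<notin> stage I i'"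
        then have "cl k (I k \<inter> stage I i') \<subseteq> cl k (I k - {x})" by (intro M.mono) auto
        moreover have "e \<in> cl k (I k \<inter> stage I i')" using e S i' by (auto simp: shrink_iff)
        ultimately show False using x by blast
      qed
      \<comment> \<open>\<open>x\<close> is now uncovered and lies outside stage \<open>i\<close>.
        Stages up to \<open>i\<close> are unchanged, so only stages up to \<open>i'\<close> can
        contain all uncovered elements, and these include \<open>stage I i'\<close>.\<close>
      have "stage I i' \<subseteq> core I'"
      proof -
        have "stage I i' \<subseteq> stage I' m" if "uncovered I' \<subseteq> stage I' m" for m
        proof -
          have "m \<le> i'"
          proof (rule ccontr)
            assume "\<not> m \<le> i'"
            then have "stage I' m \<subseteq> stage I' i" using i' by (intro stage_antimono) simp
            with that U same[of i] S xA show False by auto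
          qed
          then show ?thesis using same[of m] i' stage_antimono[of m i' I] by simp
        qed
        then show ?thesis by (auto simp: core_def)
      qed
      then have "core I \<subset> core I'"
        using \<open>core I \<subseteq> S\<close> \<open>x \<in> stage I i'\<close> xA S i' stage_antimono[of i' i I] by auto
      then have "card (core I) < card (core I')"
        using core_subset finite_A by (meson finite_subset psubset_card_mono)
      with cardU have "potential (improve c) < potential c"
        unfolding imp unfolding c by (intro potential_less) auto
      ultimately show ?thesis by blast
    qed
  qed
  then show "reached (improve c)" "improve c \<noteq> c \<Longrightarrow> potential (improve c) < potential c"
    by blast+
qed

lemma improve_fixpoint:
  assumes "reached (I, S)" "improve (I, S) = (I, S)"
  shows "valid I \<and> S \<subseteq> A \<and> uncovered I \<subseteq> S \<and> (\<forall>j. S \<subseteq> cl j (I j \<inter> S))"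
proof -
  have none: "cand I S False = {} \<and> cand I S True = {}"
  proof (cases rule: enter_cases[of I S])
    case (one k e)
    have fin: "finite {x \<in> I k - S. e \<notin> cl k (I k - {x})}"
      using assms(1) finite_A by (cases k) (auto simp: reached_def valid_def intro: finite_subset)
    \<comment> \<open>Only old elements of \<open>I k\<close> can leave, so an entering
      \<open>e\<close> would stay and change \<open>I k\<close>.\<close>
    have "leave I S k \<subseteq> I k"
      unfolding one(5) using pick_subset[OF fin] by blast
    moreover have "e \<notin> I k" using one(6) by (cases k) (auto simp: uncovered_def)
    moreover have "I k \<union> enter I S k - leave I S k = I k"
      using assms(2) unfolding improve_def by (auto dest!: fun_cong[of _ _ k])
    ultimately show ?thesis using one(2) by blast
  qed blast
  then have "shrink I S = S" using assms(2) by (simp add: improve_def)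
  then have "S \<subseteq> cl j (I j \<inter> S)" for j by (metis shrink_iff subsetI)
  moreover have "S \<subseteq> A" using assms(1) stage_subset by (auto simp: reached_def)
  ultimately show ?thesis using assms(1) by (auto simp: reached_def)
qed

text \<open>Every step that changes the state lowers the potential, so a fixed number of rounds
  replaces a test for termination.\<close>

lemma improve_iterate:
  assumes "reached c" "potential c \<le> N"
  shows "reached ((improve ^^ N) c) \<and> improve ((improve ^^ N) c) = (improve ^^ N) c"
  using assms
proof (induction N arbitrary: c)
  case 0
  then show ?case using improve_step[of c] by auto
next
  case (Suc N)
  show ?case
  proof (cases "improve c = c")
    case True
    then have "(improve ^^ m) c = c" for m by (induction m) auto
    with Suc.prems True show ?thesis by metis
  next
    case False
    with Suc.prems improve_step[of c] have "reached (improve c)" "potential (improve c) \<le> N" by auto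
    with Suc.IH show ?thesis by (simp add: funpow_swap1)
  qed
qed

lemma potential_le: "S \<subseteq> A \<Longrightarrow> potential (I, S) \<le> Suc (card A) ^ 3"
proof -
  assume "S \<subseteq> A"
  let ?a = "card A"
  have "card S \<le> ?a" "card (uncovered I) \<le> ?a"
    using \<open>S \<subseteq> A\<close> finite_A by (auto intro!: card_mono simp: uncovered_def)
  then have "potential (I, S) \<le> (?a * Suc ?a + ?a) * Suc ?a + ?a"
    unfolding potential_def prod.case by (intro add_mono mult_mono) auto
  also have "\<dots> \<le> Suc ?a ^ 3" by (simp add: power3_eq_cube algebra_simps)
  finally show ?thesis .
qed

lemma empty_reached: "reached (\<lambda>_. {}, A)"
proof -
  interpret M: matroid_closure "cl i" for i by (rule matroid)
  show ?thesis
    by (rule valid_reached) (simp add: valid_def indep_def M.indep_def)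
qed

text \<open>\<open>D\<close> will be the set of all pairs of vertices, while the \<open>I j\<close>
  consist of arcs. Optimality gives spanning of \<open>A\<close>, and this extends to
  \<open>D\<close> since subsets of \<open>A\<close> span \<open>D\<close>.\<close>

lemma improve_decides:
  assumes N: "Suc (card A) ^ 3 \<le> N" and IS: "(improve ^^ N) (\<lambda>_. {}, A) = (I, S)" and D: "A \<subseteq> D"
  shows "(\<forall>j. D \<subseteq> cl j (I j)) \<longleftrightarrow>
    (\<exists>B. B \<subseteq> A \<and> D \<subseteq> cl False B \<and> D \<subseteq> cl True (A - B))"
proof -
  interpret M: matroid_closure "cl i" for i by (rule matroid)
  have "potential (\<lambda>_. {}, A) \<le> N"
    using potential_le[of A "\<lambda>_. {}"] N by simp
  with improve_iterate[OF empty_reached this] IS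
  have opt: "valid I" "S \<subseteq> A" "uncovered I \<subseteq> S" "\<And>j. S \<subseteq> cl j (I j \<inter> S)"
    using improve_fixpoint[of I S] by auto
  show ?thesis
  proof
    assume *: "\<forall>j. D \<subseteq> cl j (I j)"
    have "I True \<subseteq> A - I False" using opt(1) by (auto simp: valid_def)
    then have "D \<subseteq> cl True (A - I False)" using * M.mono by blast
    with * opt(1) show "\<exists>B. B \<subseteq> A \<and> D \<subseteq> cl False B \<and> D \<subseteq> cl True (A - B)"
      by (intro exI[of _ "I False"]) (auto simp: valid_def)
  next
    assume "\<exists>B. B \<subseteq> A \<and> D \<subseteq> cl False B \<and> D \<subseteq> cl True (A - B)"
    then obtain B where B: "B \<subseteq> A" "D \<subseteq> cl False B" "D \<subseteq> cl True (A - B)" by blast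
    define C where "C j = (if j then A - B else B)" for j
    have C: "C j \<subseteq> A" "D \<subseteq> cl j (C j)" for j using B by (auto simp: C_def)
    have "A \<subseteq> cl j (C j)" for j using C(2) D by blast
    then have "A \<subseteq> cl j (I j)" for j
      using C(1) by (intro covering_optimal[OF opt, of C]) (auto simp: C_def)
    then have "D \<subseteq> cl j (I j)" for j
      using C(1)[of j] C(2)[of j] M.closed[of "C j" j "I j"] by blast
    then show "\<forall>j. D \<subseteq> cl j (I j)" by blast
  qed
qed

end

section \<open>The two graphic matroids of a digraph\<close>

definition conn :: "('v \<times> 'v) set \<Rightarrow> ('v \<times> 'v) set" where
  "conn R = (R \<union> R\<inverse>)\<^sup>*"

lemma conn_refl [simp]: "(x, x) \<in> conn R"
  by (simp add: conn_def)

lemma conn_sym: "(x, y) \<in> conn R \<Longrightarrow> (y, x) \<in> conn R"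
  unfolding conn_def by (rule symD[OF sym_rtrancl]) (auto simp: sym_def)

lemma conn_trans: "(x, y) \<in> conn R \<Longrightarrow> (y, z) \<in> conn R \<Longrightarrow> (x, z) \<in> conn R"
  unfolding conn_def by (rule rtrancl_trans)

lemma conn_arc: "(x, y) \<in> R \<Longrightarrow> (x, y) \<in> conn R"
  by (auto simp: conn_def)

lemma conn_closed: "R \<subseteq> conn R' \<Longrightarrow> conn R \<subseteq> conn R'"
proof -
  assume *: "R \<subseteq> conn R'"
  then have "R \<union> R\<inverse> \<subseteq> conn R'" using conn_sym[of _ _ R'] by blast
  then show ?thesis unfolding conn_def by (rule rtrancl_subset_rtrancl)
qed

lemma conn_mono: "R \<subseteq> R' \<Longrightarrow> conn R \<subseteq> conn R'"
  by (rule conn_closed) (auto intro: conn_arc)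

lemma conn_induct [consumes 1, case_names refl forward backward]:
  assumes "(x, y) \<in> conn R" "P x"
    "\<And>y z. P y \<Longrightarrow> (y, z) \<in> R \<Longrightarrow> P z" "\<And>y z. P y \<Longrightarrow> (z, y) \<in> R \<Longrightarrow> P z"
  shows "P y"
  using assms(1) unfolding conn_def
proof (induction rule: rtrancl_induct)
  case (step y z)
  with assms(3,4) show ?case by blast
qed (rule assms(2))

text \<open>A walk never needs the new edge more than once: the disjunction is preserved by every
  further edge, old or new.\<close>

lemma conn_insert:
  assumes "(x, y) \<in> conn (insert (a, b) R)"
  shows "(x, y) \<in> conn R \<or> (x, a) \<in> conn R \<and> (b, y) \<in> conn R \<or> (x, b) \<in> conn R \<and> (a, y) \<in> conn R"
  using assms
proof (induction rule: conn_induct)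
  case (forward y z)
  then consider "(y, z) \<in> conn R" | "y = a" "z = b" by (auto intro: conn_arc)
  then show ?case using forward(1) by cases (auto intro: conn_trans)
next
  case (backward y z)
  then consider "(y, z) \<in> conn R" | "y = b" "z = a" by (auto intro: conn_arc conn_sym)
  then show ?case using backward(1) by cases (auto intro: conn_trans)
qed simp

text \<open>The span ranges over the whole type and not only over arcs, so that connectedness
  becomes the inclusion of all pairs of vertices in a span.\<close>

definition graphic :: "('e \<Rightarrow> 'v \<times> 'v) \<Rightarrow> 'e set \<Rightarrow> 'e set" where
  "graphic f X = {e. f e \<in> conn (f ` X)}"

lemma graphic_matroid: "matroid_closure (graphic f)"
proof
  fix X Y :: "'a set" and x y
  show "X \<subseteq> graphic f X"
    by (auto simp: graphic_def intro: conn_arc[of "fst (f e)" "snd (f e)" for e, simplified])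
  show "X \<subseteq> graphic f Y \<Longrightarrow> graphic f X \<subseteq> graphic f Y"
    using conn_closed[of "f ` X" "f ` Y"] by (auto simp: graphic_def)
  obtain a b where x: "f x = (a, b)" by fastforce
  obtain c d where y: "f y = (c, d)" by fastforce
  assume "y \<in> graphic f (insert x X)" "y \<notin> graphic f X"
  \<comment> \<open>The connection from \<open>c\<close> to \<open>d\<close> must pass the edge
    \<open>ab\<close>; its two other parts together with the edge \<open>cd\<close> join
    \<open>a\<close> to \<open>b\<close>.\<close>
  then have "(c, a) \<in> conn (f ` X) \<and> (b, d) \<in> conn (f ` X) \<or> (c, b) \<in> conn (f ` X) \<and> (a, d) \<in> conn (f ` X)"
    using conn_insert[of c d a b "f ` X"] by (auto simp: graphic_def x y)
  moreover have "conn (f ` X) \<subseteq> conn (insert (c, d) (f ` X))" by (rule conn_mono) auto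
  moreover have "(c, d) \<in> conn (insert (c, d) (f ` X))" by (rule conn_arc) simp
  ultimately have "(a, b) \<in> conn (insert (c, d) (f ` X))"
    by (meson conn_sym conn_trans subsetD)
  then show "x \<in> graphic f (insert y X)" by (simp add: graphic_def x y)
qed

text \<open>
  The endpoints of an arc in the bipartite representation of the digraph, for \<open>False\<close>, and in
  its underlying graph, for \<open>True\<close>. The former has a tail copy \<open>Inl v\<close> and a head copy \<open>Inr v\<close>
  of each vertex; forward antidirected trails from \<open>x\<close> to \<open>y\<close> become walks from \<open>Inl x\<close> to \<open>Inr y\<close>.
\<close>

definition ends :: "bool \<Rightarrow> 'v \<times> 'v \<Rightarrow> ('v + 'v) \<times> ('v + 'v)" where
  "ends j = (\<lambda>(u, v). (Inl u, if j then Inl v else Inr v))"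

abbreviation dspan :: "bool \<Rightarrow> ('v \<times> 'v) set \<Rightarrow> ('v \<times> 'v) set" where
  "dspan j \<equiv> graphic (ends j)"

lemma dspan_iff: "(u, v) \<in> dspan j X \<longleftrightarrow> (Inl u, if j then Inl v else Inr v) \<in> conn (ends j ` X)"
  by (simp add: graphic_def ends_def)

definition lex_least :: "(nat \<times> nat) set \<Rightarrow> (nat \<times> nat) set" where
  "lex_least X = {(a, b) \<in> X. \<forall>(c, d) \<in> X. \<not> (c < a \<or> c = a \<and> d < b)}"

lemma lex_least: "X \<noteq> {} \<Longrightarrow> \<exists>x\<in>X. lex_least X = {x}"
proof -
  assume "X \<noteq> {}"
  define a where "a = (LEAST a. \<exists>b. (a, b) \<in> X)"
  define b where "b = (LEAST b. (a, b) \<in> X)"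
  have "\<exists>a b. (a, b) \<in> X" using \<open>X \<noteq> {}\<close> by auto
  then have "\<exists>b. (a, b) \<in> X" unfolding a_def by (rule LeastI_ex)
  then have ab: "(a, b) \<in> X" unfolding b_def by (rule LeastI_ex)
  moreover have "a \<le> c" "c = a \<Longrightarrow> b \<le> d" if "(c, d) \<in> X" for c d
    using that by (auto simp: a_def b_def intro: Least_le)
  ultimately have min: "(a, b) \<in> X" "\<And>c d. (c, d) \<in> X \<Longrightarrow> \<not> (c < a \<or> c = a \<and> d < b)"
    by (auto simp: not_less dest: leD)
  have "c = a \<and> d = b" if "(c, d) \<in> X" "\<not> (a < c \<or> a = c \<and> b < d)" for c d
    using min(2)[OF that(1)] that(2) by auto
  with min have "lex_least X = {(a, b)}"
    unfolding lex_least_def by blast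
  with ab show ?thesis by blast
qed

lemma lex_least_empty [simp]: "lex_least {} = {}"
  by (simp add: lex_least_def)

lemma matroid_pair_dspan: "finite A \<Longrightarrow> matroid_pair dspan A lex_least"
  by unfold_locales (auto intro: matroid_closure.extensive[OF graphic_matroid, THEN subsetD]
      matroid_closure.closed[OF graphic_matroid, THEN subsetD]
      matroid_closure.exchange[OF graphic_matroid] lex_least)

section \<open>Computing spans by iteration\<close>

lemma inflationary_fixpoint:
  assumes D: "finite D" and f: "\<And>X. X \<subseteq> D \<Longrightarrow> X \<subseteq> f X \<and> f X \<subseteq> D" and X: "X \<subseteq> D" "card D \<le> m"
  shows "f ((f ^^ m) X) = (f ^^ m) X"
proof (rule ccontr)
  assume neq: "f ((f ^^ m) X) \<noteq> (f ^^ m) X"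
  have sub: "(f ^^ i) X \<subseteq> D" for i
    by (induction i) (use f X in auto)
  \<comment> \<open>Before stabilisation every round adds an element, so \<open>m + 1\<close> rounds
    would produce more than \<open>card D\<close> of them.\<close>
  have "i \<le> card ((f ^^ i) X) \<and> (f ^^ i) X \<subset> (f ^^ Suc i) X" if "i \<le> m" for i
    using that
  proof (induction i)
    case 0
    have "f X \<noteq> X"
    proof
      assume "f X = X"
      then have "(f ^^ i) X = X" for i by (induction i) auto
      with neq \<open>f X = X\<close> show False by simp
    qed
    then show ?case using f[OF X(1)] by auto
  next
    case (Suc i)
    have grows: "f ((f ^^ Suc i) X) \<noteq> (f ^^ Suc i) X"
    proof
      assume *: "f ((f ^^ Suc i) X) = (f ^^ Suc i) X"
      have "(f ^^ (k + Suc i)) X = (f ^^ Suc i) X" for k by (induction k) (use * in auto)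
      from this[of "m - Suc i"] Suc.prems * neq show False by simp
    qed
    have "card ((f ^^ i) X) < card ((f ^^ Suc i) X)"
      using Suc D sub[of "Suc i"] by (intro psubset_card_mono) (auto intro: finite_subset)
    then show ?case using Suc grows f[OF sub[of "Suc i"]] by auto
  qed
  from this[of m] have "m < card ((f ^^ Suc m) X)"
    using D sub[of "Suc m"] by (metis finite_subset le_less_trans order_refl psubset_card_mono)
  then show False using card_mono[OF D sub[of "Suc m"]] X(2) by simp
qed

definition square :: "nat \<Rightarrow> (nat \<times> nat) set" where
  "square n = {..<n} \<times> {..<n}"

lemma square_iff [simp]: "(a, b) \<in> square n \<longleftrightarrow> a < n \<and> b < n"
  by (simp add: square_def)

text \<open>Trivial walks are the start in the underlying graph. In the bipartite graph none of them
  joins a tail copy to a head copy, so single arcs are.\<close>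

definition span_start :: "bool \<Rightarrow> (nat \<times> nat) set \<Rightarrow> (nat \<times> nat) set" where
  "span_start j X = (if j then Id else X)"

text \<open>In the bipartite graph a walk is extended by two edges at once, from the head copy of
  \<open>e\<close> to the tail copy of \<open>c\<close> and on to the head copy of
  \<open>b\<close>.\<close>

definition span_grow :: "nat \<Rightarrow> bool \<Rightarrow> (nat \<times> nat) set \<Rightarrow> (nat \<times> nat) set \<Rightarrow> (nat \<times> nat) set" where
  "span_grow n j X T = {(a, b). a < n \<and> b < n \<and> ((a, b) \<in> T \<or>
     (if j then \<exists>c<n. (a, c) \<in> T \<and> ((c, b) \<in> X \<or> (b, c) \<in> X)
      else \<exists>c<n. \<exists>e<n. (a, e) \<in> T \<and> (c, e) \<in> X \<and> (c, b) \<in> X))}"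

lemma span_grow_iterate:
  assumes X: "X \<subseteq> square n"
  shows "(span_grow n j X ^^ (n * n)) (span_start j X \<inter> square n) = dspan j X \<inter> square n"
proof
  let ?f = "span_grow n j X"
  let ?T = "(?f ^^ (n * n)) (span_start j X \<inter> square n)"
  have arc: "(Inl u, if j then Inl v else Inr v) \<in> conn (ends j ` X)" if "(u, v) \<in> X" for u v
    by (rule conn_arc) (use that in \<open>force simp: ends_def\<close>)
  have "(?f ^^ m) (span_start j X \<inter> square n) \<subseteq> dspan j X \<inter> square n" for m
  proof (induction m)
    case 0
    show ?case using arc by (cases j) (auto simp: span_start_def dspan_iff)
  next
    case (Suc m)
    show ?case
    proof (rule subrelI)
      fix a b assume "(a, b) \<in> (?f ^^ Suc m) (span_start j X \<inter> square n)"
      then have ab: "(a, b) \<in> span_grow n j X ((?f ^^ m) (span_start j X \<inter> square n))" by simp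
      let ?U = "(?f ^^ m) (span_start j X \<inter> square n)"
      have U: "(Inl a, if j then Inl c else Inr c) \<in> conn (ends j ` X)" if "(a, c) \<in> ?U" for c
        using that Suc by (auto simp: dspan_iff)
      have "(Inl a, if j then Inl b else Inr b) \<in> conn (ends j ` X)"
      proof (cases "(a, b) \<in> ?U")
        case True
        then show ?thesis by (rule U)
      next
        case False
        show ?thesis
        proof (cases j)
          case True
          with False ab obtain c where "(a, c) \<in> ?U" "(c, b) \<in> X \<or> (b, c) \<in> X"
            by (auto simp: span_grow_def)
          with U[of c] arc[of c b] arc[of b c] True show ?thesis by (auto intro: conn_trans conn_sym)
        next
          case j: False
          with False ab obtain c e where "(a, e) \<in> ?U" "(c, e) \<in> X" "(c, b) \<in> X"
            by (auto simp: span_grow_def)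
          with U[of e] arc[of c e] arc[of c b] j show ?thesis
            by simp (meson conn_sym conn_trans)
        qed
      qed
      with ab show "(a, b) \<in> dspan j X \<inter> square n" by (simp add: dspan_iff span_grow_def)
    qed
  qed
  then show "?T \<subseteq> dspan j X \<inter> square n" .
  have "?f ?T = ?T"
    by (rule inflationary_fixpoint[of "square n"]) (auto simp: span_grow_def square_def)
  have start: "span_start j X \<inter> square n \<subseteq> ?T"
  proof -
    have "span_start j X \<inter> square n \<subseteq> (?f ^^ m) (span_start j X \<inter> square n)" for m
      by (induction m) (auto simp: span_grow_def)
    then show ?thesis .
  qed
  define T where "T = ?T"
  have T: "(a, b) \<in> T" if "(a, b) \<in> span_grow n j X T" for a b
    using that \<open>?f ?T = ?T\<close> unfolding T_def by simp
  have XD: "u < n \<and> v < n" if "(u, v) \<in> X" for u v using that X by auto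
  have "dspan j X \<inter> square n \<subseteq> T"
  proof (rule subrelI)
    fix a b assume "(a, b) \<in> dspan j X \<inter> square n"
    then have ab: "(Inl a, if j then Inl b else Inr b) \<in> conn (ends j ` X)" "a < n" "b < n"
      by (auto simp: dspan_iff)
    show "(a, b) \<in> T"
    proof (cases j)
      case True
      have grow: "(a, v) \<in> T" if "(a, u) \<in> T" "(u, v) \<in> X \<or> (v, u) \<in> X" for u v
        by (rule T) (use that True ab XD in \<open>auto simp: span_grow_def\<close>)
      have "\<exists>c. y = Inl c \<and> (a, c) \<in> T" if "(Inl a, y) \<in> conn (ends j ` X)" for y
        using that
      proof (induction rule: conn_induct)
        case refl
        then show ?case using start ab True by (auto simp: span_start_def T_def)
      next
        case (forward y z)
        then show ?case using True grow by (auto simp: ends_def)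
      next
        case (backward y z)
        then show ?case using True grow by (auto simp: ends_def)
      qed
      with ab True show ?thesis by fastforce
    next
      case False
      have base: "(a, v) \<in> T" if "(a, v) \<in> X" for v
        using start that XD False by (auto simp: span_start_def T_def)
      have grow: "(a, v) \<in> T" if "(a, w) \<in> T" "(u, w) \<in> X" "(u, v) \<in> X" for u v w
        by (rule T) (use that False ab XD in \<open>auto simp: span_grow_def\<close>)
      \<comment> \<open>Head copies met by a walk are recorded in \<open>T\<close>. A tail copy is
        \<open>a\<close> itself or has an arc to a recorded head copy, which is what
        \<open>grow\<close> asks for.\<close>
      have "(\<exists>c. y = Inr c \<and> (a, c) \<in> T) \<or> (\<exists>c. y = Inl c \<and> (c = a \<or> (\<exists>e. (a, e) \<in> T \<and> (c, e) \<in> X)))"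
        if "(Inl a, y) \<in> conn (ends j ` X)" for y
        using that
      proof (induction rule: conn_induct)
        case (forward y z)
        then obtain c b where c: "y = Inl c" "z = Inr b" "(c, b) \<in> X"
          "c = a \<or> (\<exists>e. (a, e) \<in> T \<and> (c, e) \<in> X)"
          using False by (auto simp: ends_def)
        with base grow show ?case by auto
      next
        case (backward y z)
        then show ?case using False by (auto simp: ends_def)
      qed simp
      with ab False show ?thesis by fastforce
    qed
  qed
  then show "dspan j X \<inter> square n \<subseteq> ?T" by (simp add: T_def)
qed

section \<open>The augmentation algorithm as a program\<close>

text \<open>\<open>k\<close> nested loops give \<open>n ^ k\<close> rounds. The body takes its depth
  as an argument because variables are levels.\<close>

primrec rept :: "nat \<Rightarrow> nat \<Rightarrow> (nat \<Rightarrow> com) \<Rightarrow> com" where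
  "rept 0 d c = c d"
| "rept (Suc k) d c = For (rept k (Suc d) c)"

lemma com_wf_rept: "(\<And>d. com_wf d (c d)) \<Longrightarrow> com_wf d (rept k d c)"
  by (induction k arbitrary: d) auto

text \<open>\<open>h\<close> extracts the data on which the body acts as \<open>g\<close>, whatever
  the values of the loop variables, as long as the invariant \<open>Q\<close> holds.\<close>

lemma sem_rept:
  assumes step: "\<And>env st. Q st \<Longrightarrow>
      Q (sem n env (c (length env)) st) \<and> h (sem n env (c (length env)) st) = g (h st)"
    and "Q st"
  shows "Q (sem n env (rept k (length env) c) st) \<and>
    h (sem n env (rept k (length env) c) st) = (g ^^ (n ^ k)) (h st)"
  using \<open>Q st\<close>
proof (induction k arbitrary: env st)
  case (Suc k)
  note outer = Suc.IH
  let ?f = "\<lambda>m. fold (\<lambda>x. sem n (env @ [x]) (rept k (Suc (length env)) c)) [0..<m] st"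
  have "Q (?f m) \<and> h (?f m) = (g ^^ (m * n ^ k)) (h st)" for m
  proof (induction m)
    case (Suc m)
    have "?f (Suc m) = sem n (env @ [m]) (rept k (length (env @ [m])) c) (?f m)" by simp
    then show ?case
      using outer[of "?f m" "env @ [m]"] Suc by (simp add: funpow_add)
  qed (use Suc.prems in simp)
  then show ?case by simp
qed (use step in simp)

text \<open>A frame condition: \<open>K\<close> lists the relations that may have been
  overwritten.\<close>

definition agree :: "nat set \<Rightarrow> store \<Rightarrow> store \<Rightarrow> bool" where
  "agree K st st' \<longleftrightarrow> (\<forall>k. k \<notin> K \<longrightarrow> st' k = st k)"

lemma agreeD: "agree K st st' \<Longrightarrow> k \<notin> K \<Longrightarrow> st' k = st k"
  by (simp add: agree_def)

lemma agree_refl [simp]: "agree K st st"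
  by (simp add: agree_def)

lemma agree_trans: "agree K st st' \<Longrightarrow> agree K' st' st'' \<Longrightarrow> K \<union> K' \<subseteq> L \<Longrightarrow> agree L st st''"
  unfolding agree_def by (metis UnI1 UnI2 subsetD)

lemma sem_Assign_agree:
  assumes "\<And>a b X. a < n \<Longrightarrow> b < n \<Longrightarrow>
      eval n (env @ [a, b]) (st(1 := X)) \<phi> = eval n (env @ [a, b]) st \<phi>"
    and "0 < n" and "k \<noteq> 1"
  shows "agree {1, k} st (sem n env (Assign (length env) k \<phi>) st)"
    "sem n env (Assign (length env) k \<phi>) st k =
      {(a, b). a < n \<and> b < n \<and> eval n (env @ [a, b]) st \<phi>}"
  using sem_Assign[OF assms(1,2) refl assms(3)] by (simp_all add: agree_def)

abbreviation Exists2 :: "fm \<Rightarrow> fm" where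
  "Exists2 \<phi> \<equiv> Exists (Exists \<phi>)"

text \<open>The input is relation 5. The two loops of \<open>rept 2\<close> supply the
  \<open>n * n\<close> rounds of \<open>span_grow_iterate\<close>.\<close>

definition span_code :: "bool \<Rightarrow> nat \<Rightarrow> nat \<Rightarrow> com" where
  "span_code j t d = Seq
     (Assign d t (if j then Equal d (d + 1) else Rel 5 d (d + 1)))
     (rept 2 d (\<lambda>d. Assign d t (Disj (Rel t d (d + 1))
       (if j then Exists (Conj (Rel t d (d + 2)) (Disj (Rel 5 (d + 2) (d + 1)) (Rel 5 (d + 1) (d + 2))))
        else Exists2 (Conj (Rel t d (d + 3)) (Conj (Rel 5 (d + 2) (d + 3)) (Rel 5 (d + 2) (d + 1))))))))"

lemma span_code_wf: "com_wf d (span_code j t d)"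
  by (auto simp: span_code_def intro!: com_wf_rept)

lemma sem_span_code:
  assumes n: "0 < n" and X: "st 5 \<subseteq> square n" and t: "t \<notin> {1, 5}"
  shows "agree {1, t} st (sem n env (span_code j t (length env)) st)"
    "sem n env (span_code j t (length env)) st t = dspan j (st 5) \<inter> square n"
proof -
  let ?start = "\<lambda>d. Assign d t (if j then Equal d (d + 1) else Rel 5 d (d + 1))"
  let ?grow = "\<lambda>d. Assign d t (Disj (Rel t d (d + 1))
       (if j then Exists (Conj (Rel t d (d + 2)) (Disj (Rel 5 (d + 2) (d + 1)) (Rel 5 (d + 1) (d + 2))))
        else Exists2 (Conj (Rel t d (d + 3)) (Conj (Rel 5 (d + 2) (d + 3)) (Rel 5 (d + 2) (d + 1))))))"
  let ?st = "sem n env (?start (length env)) st"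
  have start: "agree {1, t} st ?st" "?st t = span_start j (st 5) \<inter> square n"
    using n t by (subst sem_Assign_agree; auto simp: nth_append span_start_def)+
  have step: "agree {1, t} st (sem n env (?grow (length env)) s) \<and>
      sem n env (?grow (length env)) s t = span_grow n j (st 5) (s t)"
    if "agree {1, t} st s" for env s
  proof -
    have *: "agree {1, t} s (sem n env (?grow (length env)) s)"
      using n t by (intro sem_Assign_agree(1)) (auto simp: nth_append)
    have "s 5 = st 5" using that t by (intro agreeD) auto
    then have "sem n env (?grow (length env)) s t = span_grow n j (st 5) (s t)"
      using n t by (subst sem_Assign_agree(2)) (auto simp: nth_append span_grow_def)
    with * that show ?thesis by (auto intro: agree_trans)
  qed
  have "agree {1, t} st (sem n env (rept 2 (length env) ?grow) ?st) \<and>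
    sem n env (rept 2 (length env) ?grow) ?st t = (span_grow n j (st 5) ^^ (n ^ 2)) (?st t)"
    by (rule sem_rept[where Q = "agree {1, t} st" and h = "\<lambda>s. s t"]) (use step start in auto)
  then show "agree {1, t} st (sem n env (span_code j t (length env)) st)"
    "sem n env (span_code j t (length env)) st t = dspan j (st 5) \<inter> square n"
    unfolding span_code_def sem.simps start(2) using span_grow_iterate[OF X]
    by (simp_all add: power2_eq_square)
qed

definition pick_code :: "nat \<Rightarrow> nat \<Rightarrow> com" where
  "pick_code k d = Assign d k (Conj (Rel k d (d + 1)) (Neg (Exists2 (Conj (Rel k (d + 2) (d + 3))
     (Disj (Less (d + 2) d) (Conj (Equal (d + 2) d) (Less (d + 3) (d + 1))))))))"

lemma pick_code_wf: "com_wf d (pick_code k d)"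
  by (simp add: pick_code_def)

lemma sem_pick_code:
  assumes "0 < n" "st k \<subseteq> square n" "k \<noteq> 1"
  shows "agree {1, k} st (sem n env (pick_code k (length env)) st)"
    "sem n env (pick_code k (length env)) st k = lex_least (st k)"
proof -
  show "agree {1, k} st (sem n env (pick_code k (length env)) st)"
    unfolding pick_code_def using assms by (intro sem_Assign_agree(1)) (auto simp: nth_append)
  have "sem n env (pick_code k (length env)) st k = {(a, b). a < n \<and> b < n \<and> (a, b) \<in> st k \<and>
      \<not> (\<exists>c<n. \<exists>d<n. (c, d) \<in> st k \<and> (c < a \<or> c = a \<and> d < b))}"
    unfolding pick_code_def using assms by (subst sem_Assign_agree(2)) (auto simp: nth_append)
  also have "\<dots> = lex_least (st k)"
  proof -
    have sub: "c < n \<and> d < n" if "(c, d) \<in> st k" for c d using that assms(2) by auto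
    then have "(\<exists>c<n. \<exists>d<n. (c, d) \<in> st k \<and> R c d) \<longleftrightarrow> (\<exists>c d. (c, d) \<in> st k \<and> R c d)" for R by blast
    with sub show ?thesis unfolding lex_least_def by (simp only:) blast
  qed
  finally show "sem n env (pick_code k (length env)) st k = lex_least (st k)" .
qed

text \<open>
  Relation 0 is the set of arcs, 2 and 3 are the independent sets of the pair of matroids, 4 is
  the set \<open>S\<close> of \<open>improve\<close>, and the rest is scratch.
\<close>

definition mem :: "bool \<Rightarrow> nat" where
  "mem j = (if j then 3 else 2)"

text \<open>The span has to be computed anew for each removed element. Variables \<open>d\<close>
  and \<open>d + 1\<close> of the loops name the pair under test, relation 5 is the independent set
  without it, relation 12 the resulting span, and the last assignment may add this pair alone to
  \<open>l\<close>. \<open>Less d d\<close> is false, so \<open>l\<close> starts empty.\<close>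

definition leave_code :: "bool \<Rightarrow> nat \<Rightarrow> nat \<Rightarrow> nat \<Rightarrow> com" where
  "leave_code j e l d = Seq (Assign d l (Less d d)) (Seq
     (For (For (Seq
       (Assign (d + 2) 5 (Conj (Rel (mem j) (d + 2) (d + 3))
         (Neg (Conj (Equal (d + 2) d) (Equal (d + 3) (d + 1)))))) (Seq
       (span_code j 12 (d + 2))
       (Assign (d + 2) l (Disj (Rel l (d + 2) (d + 3))
         (Conj (Conj (Equal (d + 2) d) (Equal (d + 3) (d + 1)))
         (Conj (Conj (Rel (mem j) (d + 2) (d + 3)) (Neg (Rel 4 (d + 2) (d + 3))))
           (Exists2 (Conj (Rel e (d + 4) (d + 5)) (Neg (Rel 12 (d + 4) (d + 5)))))))))))))
     (pick_code l d))"

lemma leave_code_wf: "com_wf d (leave_code j e l d)"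
  using span_code_wf[of "d + 2"] pick_code_wf[of d] by (simp add: leave_code_def)

text \<open>Each round decides about its own pair only, so the rounds together assemble
  \<open>W\<close>.\<close>

lemma sem_For_For:
  assumes step: "\<And>p q s. p < n \<Longrightarrow> q < n \<Longrightarrow> agree K st s \<Longrightarrow> s l \<subseteq> square n \<Longrightarrow>
      agree K st (sem n (env @ [p, q]) c s) \<and> sem n (env @ [p, q]) c s l = s l \<union> (W \<inter> {(p, q)})"
    and st: "st l = {}" and W: "W \<subseteq> square n"
  shows "agree K st (sem n env (For (For c)) st) \<and> sem n env (For (For c)) st l = W"
proof -
  have inner: "agree K st (fold (\<lambda>q. sem n (env @ [p, q]) c) [0..<m] s) \<and>
      fold (\<lambda>q. sem n (env @ [p, q]) c) [0..<m] s l = s l \<union> (W \<inter> {p} \<times> {..<m})"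
    if "p < n" "m \<le> n" "agree K st s" "s l \<subseteq> square n" for p m s
    using that(2)
  proof (induction m)
    case (Suc m)
    let ?s = "fold (\<lambda>q. sem n (env @ [p, q]) c) [0..<m] s"
    have "agree K st ?s" "?s l = s l \<union> (W \<inter> {p} \<times> {..<m})" using Suc by auto
    moreover from this have "?s l \<subseteq> square n" using that(4) W by auto
    ultimately have "agree K st (sem n (env @ [p, m]) c ?s) \<and>
        sem n (env @ [p, m]) c ?s l = ?s l \<union> (W \<inter> {(p, m)})"
      using Suc.prems that by (intro step) simp_all
    moreover have "W \<inter> {p} \<times> {..<Suc m} = (W \<inter> {p} \<times> {..<m}) \<union> (W \<inter> {(p, m)})"
      by (auto simp: less_Suc_eq)
    ultimately show ?case
      using \<open>?s l = s l \<union> (W \<inter> {p} \<times> {..<m})\<close> unfolding fold_upt_Suc by (simp only: Un_assoc)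
  qed (use that in auto)
  have outer: "agree K st (fold (\<lambda>p. fold (\<lambda>q. sem n (env @ [p, q]) c) [0..<n]) [0..<m] st) \<and>
      fold (\<lambda>p. fold (\<lambda>q. sem n (env @ [p, q]) c) [0..<n]) [0..<m] st l = W \<inter> {..<m} \<times> {..<n}"
    if "m \<le> n" for m
    using that
  proof (induction m)
    case (Suc m)
    let ?s = "fold (\<lambda>p. fold (\<lambda>q. sem n (env @ [p, q]) c) [0..<n]) [0..<m] st"
    have "agree K st ?s" "?s l = W \<inter> {..<m} \<times> {..<n}" using Suc by auto
    moreover from this have "?s l \<subseteq> square n" using W by auto
    ultimately have "agree K st (fold (\<lambda>q. sem n (env @ [m, q]) c) [0..<n] ?s) \<and>
        fold (\<lambda>q. sem n (env @ [m, q]) c) [0..<n] ?s l = ?s l \<union> (W \<inter> {m} \<times> {..<n})"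
      using Suc.prems by (intro inner) simp_all
    moreover have "W \<inter> {..<Suc m} \<times> {..<n} = (W \<inter> {..<m} \<times> {..<n}) \<union> (W \<inter> {m} \<times> {..<n})"
      by (auto simp: less_Suc_eq)
    ultimately show ?case
      using \<open>?s l = W \<inter> {..<m} \<times> {..<n}\<close> unfolding fold_upt_Suc by (simp only:)
  qed (use st in auto)
  have "W \<inter> {..<n} \<times> {..<n} = W" using W by (auto simp: square_def)
  with outer[of n] show ?thesis by (simp add: sem_For)
qed

lemma sem_leave_code:
  fixes st :: store and env :: "nat list"
  assumes n: "0 < n" and sub: "st (mem j) \<subseteq> square n" "st e \<subseteq> square n"
    and le: "l \<notin> {1, 5, 12, e, 4, 2, 3}" "e \<notin> {1, 5, 12}"
  defines "st' \<equiv> sem n env (leave_code j e l (length env)) st"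
  shows "agree {1, 5, 12, l} st st'"
    "st' l = lex_least {x \<in> st (mem j) - st 4. \<exists>y\<in>st e. y \<notin> dspan j (st (mem j) - {x})}"
proof -
  let ?K = "{1, 5, 12, l}"
  let ?d = "length env"
  define W where "W = {x \<in> st (mem j) - st 4. \<exists>y\<in>st e. y \<notin> dspan j (st (mem j) - {x})}"
  have W: "W \<subseteq> square n" using sub by (auto simp: W_def)
  have mem: "mem j \<notin> {1, 5, 12, l}" using le by (auto simp: mem_def)
  define s0 where "s0 = sem n env (Assign ?d l (Less ?d ?d)) st"
  have s0: "agree ?K st s0" "s0 l = {}"
    unfolding s0_def using n le sem_Assign_agree[of n env st "Less ?d ?d" l] by (auto simp: agree_def)
  define c1 where "c1 = (\<lambda>d. Assign (d + 2) 5 (Conj (Rel (mem j) (d + 2) (d + 3))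
         (Neg (Conj (Equal (d + 2) d) (Equal (d + 3) (d + 1))))))"
  define c3 where "c3 = (\<lambda>d. Assign (d + 2) l (Disj (Rel l (d + 2) (d + 3))
         (Conj (Conj (Equal (d + 2) d) (Equal (d + 3) (d + 1)))
         (Conj (Conj (Rel (mem j) (d + 2) (d + 3)) (Neg (Rel 4 (d + 2) (d + 3))))
           (Exists2 (Conj (Rel e (d + 4) (d + 5)) (Neg (Rel 12 (d + 4) (d + 5)))))))))"
  define c where "c = Seq (c1 ?d) (Seq (span_code j 12 (?d + 2)) (c3 ?d))"
  have loop: "agree ?K s0 (sem n env (For (For c)) s0) \<and> sem n env (For (For c)) s0 l = W"
  proof (rule sem_For_For)
    fix p q s
    assume pq: "p < n" "q < n" "agree ?K s0 s" "s l \<subseteq> square n"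
    let ?env = "env @ [p, q]"
    have len: "?d + 2 = length ?env" by simp
    have ag: "agree ?K st s" using s0(1) pq(3) by (rule agree_trans) auto
    then have s: "s (mem j) = st (mem j)" "s 4 = st 4" "s e = st e"
      using mem le by (auto intro!: agreeD)
    define s1 where "s1 = sem n ?env (c1 ?d) s"
    have s1: "agree {1, 5} s s1" "s1 5 = st (mem j) - {(p, q)}"
      unfolding s1_def c1_def len using n mem sub(1)
      by (subst sem_Assign_agree; auto simp: nth_append s)+
    define s2 where "s2 = sem n ?env (span_code j 12 (?d + 2)) s1"
    have s2: "agree {1, 12} s1 s2" "s2 12 = dspan j (st (mem j) - {(p, q)}) \<inter> square n"
      unfolding s2_def len using sem_span_code[of n s1 12 ?env j] n sub(1) s1(2) by auto
    have s2_eq: "s2 (mem j) = st (mem j)" "s2 4 = st 4" "s2 e = st e" "s2 l = s l"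
      using s1(1) s2(1) s mem le by (auto simp: agree_def)
    define s3 where "s3 = sem n ?env (c3 ?d) s2"
    have s3: "agree {1, l} s2 s3"
      unfolding s3_def c3_def len using n mem le
      by (intro sem_Assign_agree(1)) (auto simp: nth_append)
    have "s3 l = {(a, b). a < n \<and> b < n \<and> ((a, b) \<in> s l \<or> a = p \<and> b = q \<and>
        (a, b) \<in> st (mem j) \<and> (a, b) \<notin> st 4 \<and>
        (\<exists>c<n. \<exists>d<n. (c, d) \<in> st e \<and> (c, d) \<notin> dspan j (st (mem j) - {(p, q)})))}"
      unfolding s3_def c3_def len using n mem le
      by (subst sem_Assign_agree(2)) (auto simp: nth_append s2_eq s2(2))
    also have "\<dots> = s l \<union> (W \<inter> {(p, q)})"
      using pq(1,2,4) sub(2) by (fastforce simp: W_def square_def)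
    finally have "s3 l = s l \<union> (W \<inter> {(p, q)})" .
    moreover have "agree ?K s0 s3"
      using pq(3) s1(1) s2(1) s3 by (auto simp: agree_def)
    moreover have "sem n ?env c s = s3"
      by (simp add: c_def s1_def s2_def s3_def)
    ultimately show "agree ?K s0 (sem n ?env c s) \<and> sem n ?env c s l = s l \<union> (W \<inter> {(p, q)})" by simp
  qed (use s0 W in auto)
  define s1 where "s1 = sem n env (For (For c)) s0"
  have "st' = sem n env (pick_code l ?d) s1"
    by (simp add: st'_def leave_code_def s1_def s0_def c_def c1_def c3_def)
  then have "agree {1, l} s1 st'" "st' l = lex_least W"
    using sem_pick_code[of n s1 l env] n loop le W by (auto simp: s1_def)
  then show "agree ?K st st'"
    "st' l = lex_least {x \<in> st (mem j) - st 4. \<exists>y\<in>st e. y \<notin> dspan j (st (mem j) - {x})}"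
    using loop s0(1) by (auto simp: agree_def s1_def W_def)
qed

text \<open>Relations 6 and 7 hold the two spans, 8 and 9 first the candidates and then the entering
  elements, 10 and 11 the leaving ones. Relations 4, 2 and 3 come last, since the computations
  before them read the old values.\<close>

definition step_code :: "nat \<Rightarrow> com" where
  "step_code d =
    (let here = (\<lambda>k. Rel k d (d + 1));
      uncovered = Conj (here 0) (Conj (Neg (here 2)) (Neg (here 3)));
      found = Disj (Exists2 (Rel 8 (d + 2) (d + 3))) (Exists2 (Rel 9 (d + 2) (d + 3)))
    in Seq (Assign d 5 (Conj (here 2) (here 4))) (Seq (span_code False 6 d)
      (Seq (Assign d 5 (Conj (here 3) (here 4))) (Seq (span_code True 7 d)
      (Seq (Assign d 8 (Conj uncovered (Neg (here 6))))
      (Seq (Assign d 9 (Conj (Conj uncovered (Neg (here 7))) (Neg (Exists2 (Rel 8 (d + 2) (d + 3))))))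
      (Seq (pick_code 8 d) (Seq (pick_code 9 d)
      (Seq (leave_code False 8 10 d) (Seq (leave_code True 9 11 d)
      (Seq (Assign d 4 (Disj (Conj found (here 0)) (Conj (Neg found) (Conj (here 4) (Conj (here 6) (here 7))))))
      (Seq (Assign d 2 (Conj (Disj (here 2) (here 8)) (Neg (here 10))))
      (Assign d 3 (Conj (Disj (here 3) (here 9)) (Neg (here 11))))))))))))))))"

lemma step_code_wf: "com_wf d (step_code d)"
  by (simp add: step_code_def Let_def span_code_wf pick_code_wf leave_code_wf)

definition state :: "store \<Rightarrow> (bool \<Rightarrow> (nat \<times> nat) set) \<times> (nat \<times> nat) set" where
  "state st = ((\<lambda>j. st (mem j)), st 4)"

lemma sem_step_code:
  fixes st :: store and env :: "nat list"
  assumes n: "0 < n" and A: "st 0 = A" "A \<subseteq> square n" and sub: "st 2 \<subseteq> A" "st 3 \<subseteq> A" "st 4 \<subseteq> A"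
  defines "st' \<equiv> sem n env (step_code (length env)) st"
  shows "st' 0 = A" "st' 2 \<subseteq> A" "st' 3 \<subseteq> A" "st' 4 \<subseteq> A"
    "state st' = matroid_pair.improve dspan A lex_least (state st)"
proof -
  have "finite A" using A(2) by (rule finite_subset) (simp add: square_def)
  then interpret P: matroid_pair dspan A lex_least by (rule matroid_pair_dspan)
  let ?d = "length env"
  let ?here = "\<lambda>k. Rel k ?d (?d + 1)"
  let ?uncovered = "Conj (?here 0) (Conj (Neg (?here 2)) (Neg (?here 3)))"
  let ?found = "Disj (Exists2 (Rel 8 (?d + 2) (?d + 3))) (Exists2 (Rel 9 (?d + 2) (?d + 3)))"
  define I where "I = (\<lambda>j. st (mem j))"
  define S where "S = st 4"
  have I: "I False = st 2" "I True = st 3" by (simp_all add: I_def mem_def)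
  have sq: "st 2 \<subseteq> square n" "st 3 \<subseteq> square n" "st 4 \<subseteq> square n" using sub A by auto
  note assign = sem_Assign_agree[of n env, OF _ n]
  define s1 where "s1 = sem n env (Assign ?d 5 (Conj (?here 2) (?here 4))) st"
  have s1: "agree {1, 5} st s1" "s1 5 = I False \<inter> S"
    unfolding s1_def using sq by (subst assign; auto simp: nth_append I S_def)+
  define s2 where "s2 = sem n env (span_code False 6 ?d) s1"
  have s2: "agree {1, 6} s1 s2" "s2 6 = dspan False (I False \<inter> S) \<inter> square n"
    unfolding s2_def using sem_span_code[of n s1 6 env False] n sq s1 by (auto simp: I)
  note d2 = agreeD[OF s2(1)] agreeD[OF s1(1)]
  define s3 where "s3 = sem n env (Assign ?d 5 (Conj (?here 3) (?here 4))) s2"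
  have s3: "agree {1, 5} s2 s3" "s3 5 = I True \<inter> S"
    unfolding s3_def using sq by (subst assign; auto simp: nth_append I S_def d2)+
  define s4 where "s4 = sem n env (span_code True 7 ?d) s3"
  have s4: "agree {1, 7} s3 s4" "s4 7 = dspan True (I True \<inter> S) \<inter> square n"
    unfolding s4_def using sem_span_code[of n s3 7 env True] n sq s3 by (auto simp: I)
  note d4 = agreeD[OF s4(1)] agreeD[OF s3(1)] d2
  define s5 where "s5 = sem n env (Assign ?d 8 (Conj ?uncovered (Neg (?here 6)))) s4"
  have s5: "agree {1, 8} s4 s5" "s5 8 = P.cand I S False"
    unfolding s5_def using A
    by (subst assign; auto simp: nth_append I d4 s2(2) P.cand_def P.uncovered_def)+
  define s6 where "s6 = sem n env (Assign ?d 9 (Conj (Conj ?uncovered (Neg (?here 7)))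
      (Neg (Exists2 (Rel 8 (?d + 2) (?d + 3)))))) s5"
  have candF: "P.cand I S False \<subseteq> A" and candT: "P.cand I S True \<subseteq> A"
    by (auto simp: P.cand_def P.uncovered_def)
  have ex: "(\<exists>c<n. \<exists>e<n. (c, e) \<in> X) \<longleftrightarrow> X \<noteq> {}" if "X \<subseteq> A" for X
    using that A(2) by fastforce
  note d5 = agreeD[OF s5(1)] d4
  have s6: "agree {1, 9} s5 s6"
    unfolding s6_def by (rule assign(1)) (simp_all add: nth_append)
  have "s6 9 = {(a, b). a < n \<and> b < n \<and> ((a, b) \<in> A \<and> (a, b) \<notin> st 2 \<and> (a, b) \<notin> st 3 \<and>
      \<not> ((a, b) \<in> dspan True (I True \<inter> S) \<and> a < n \<and> b < n)) \<and>
      \<not> (\<exists>c<n. \<exists>e<n. (c, e) \<in> P.cand I S False)}"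
    unfolding s6_def by (subst assign(2)) (auto simp: nth_append d5 s4(2) s5(2) A(1))
  also have "\<dots> = P.cand I S True"
    unfolding ex[OF candF] using A(2)
    by (auto simp: P.cand_def P.uncovered_def I)
  finally have s6': "s6 9 = P.cand I S True" .
  note d6 = agreeD[OF s6] d5
  define s7 where "s7 = sem n env (pick_code 8 ?d) s6"
  have s7: "agree {1, 8} s6 s7" "s7 8 = P.enter I S False"
    unfolding s7_def using sem_pick_code[of n s6 8 env] n candF A(2) by (auto simp: d6 s5(2) P.enter_def)
  define s8 where "s8 = sem n env (pick_code 9 ?d) s7"
  have s8: "agree {1, 9} s7 s8" "s8 9 = P.enter I S True"
    unfolding s8_def using sem_pick_code[of n s7 9 env] n candT A(2)
    by (auto simp: agreeD[OF s7(1)] s6' P.enter_def)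
  note d8 = agreeD[OF s8(1)] agreeD[OF s7(1)] d6
  have finite_cand: "finite (P.cand I S j)" for j
    using \<open>finite A\<close> by (auto simp: P.cand_def P.uncovered_def)
  \<comment> \<open>A choice is empty only if there are no candidates, so \<open>?found\<close> can
    be tested after the choices have replaced the candidates.\<close>
  have enter: "P.enter I S j \<subseteq> P.cand I S j" "P.enter I S j = {} \<longleftrightarrow> P.cand I S j = {}" for j
    using P.pick[OF finite_cand, of j] unfolding P.enter_def by (cases "P.cand I S j = {}"; auto)+
  have enterA: "P.enter I S j \<subseteq> A" for j
    using enter(1)[of j] candF candT by (cases j) auto
  define s9 where "s9 = sem n env (leave_code False 8 10 ?d) s8"
  have s9: "agree {1, 5, 12, 10} s8 s9" "s9 10 = P.leave I S False"
    unfolding s9_def using sem_leave_code[where n = n and st = s8 and j = False and e = 8 and l = 10 and env = env] n sq enterA[of False] A(2)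
    by (auto simp: mem_def d8 s7(2) P.leave_def I S_def)
  define s10 where "s10 = sem n env (leave_code True 9 11 ?d) s9"
  have s10: "agree {1, 5, 12, 11} s9 s10" "s10 11 = P.leave I S True"
    unfolding s10_def using sem_leave_code[where n = n and st = s9 and j = True and e = 9 and l = 11 and env = env] n sq enterA[of True] A(2)
    by (auto simp: mem_def agreeD[OF s9(1)] d8 s8(2) P.leave_def I S_def)
  note d10 = agreeD[OF s10(1)] agreeD[OF s9(1)] d8
  define s11 where "s11 = sem n env (Assign ?d 4 (Disj (Conj ?found (?here 0))
      (Conj (Neg ?found) (Conj (?here 4) (Conj (?here 6) (?here 7)))))) s10"
  have s11: "agree {1, 4} s10 s11"
    unfolding s11_def by (rule assign(1)) (simp_all add: nth_append)
  have "s11 4 = {(a, b). a < n \<and> b < n \<and>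
      (((\<exists>c<n. \<exists>e<n. (c, e) \<in> P.enter I S False) \<or> (\<exists>c<n. \<exists>e<n. (c, e) \<in> P.enter I S True)) \<and> (a, b) \<in> A \<or>
       \<not> ((\<exists>c<n. \<exists>e<n. (c, e) \<in> P.enter I S False) \<or> (\<exists>c<n. \<exists>e<n. (c, e) \<in> P.enter I S True)) \<and>
       (a, b) \<in> P.shrink I S)}"
    unfolding s11_def
    by (subst assign(2)) (auto simp: nth_append d10 s7(2) s8(2) s4(2) s2(2) A(1) S_def P.shrink_def)
  also have "\<dots> = (if P.cand I S False = {} \<and> P.cand I S True = {} then P.shrink I S else A)"
    unfolding ex[OF enterA] enter(2) using sq(3) A(2) by (auto simp: P.shrink_def S_def)
  finally have s11': "s11 4 = (if P.cand I S False = {} \<and> P.cand I S True = {} then P.shrink I S else A)" .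
  note d11 = agreeD[OF s11] d10
  define s12 where "s12 = sem n env (Assign ?d 2 (Conj (Disj (?here 2) (?here 8)) (Neg (?here 10)))) s11"
  have s12: "agree {1, 2} s11 s12" "s12 2 = (I False \<union> P.enter I S False) - P.leave I S False"
    unfolding s12_def using enterA[of False] sub A(2)
    by (subst assign; auto simp: nth_append I d11 s7(2) s9(2))+
  note d12 = agreeD[OF s12(1)] d11
  define s13 where "s13 = sem n env (Assign ?d 3 (Conj (Disj (?here 3) (?here 9)) (Neg (?here 11)))) s12"
  have s13: "agree {1, 3} s12 s13" "s13 3 = (I True \<union> P.enter I S True) - P.leave I S True"
    unfolding s13_def using enterA[of True] sub A(2)
    by (subst assign; auto simp: nth_append I d12 s8(2) s10(2))+
  note d13 = agreeD[OF s13(1)] d12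
  have st': "st' = s13"
    unfolding st'_def step_code_def Let_def sem.simps s1_def s2_def s3_def s4_def s5_def s6_def s7_def
      s8_def s9_def s10_def s11_def s12_def s13_def ..
  have vals: "s13 0 = A" "s13 2 = (I False \<union> P.enter I S False) - P.leave I S False"
    "s13 4 = (if P.cand I S False = {} \<and> P.cand I S True = {} then P.shrink I S else A)"
    using A s11' s12(2) by (simp_all add: d13)
  show "st' 0 = A" "st' 2 \<subseteq> A" "st' 3 \<subseteq> A" "st' 4 \<subseteq> A"
  proof -
    have "P.shrink I S \<subseteq> A" using sub(3) by (auto simp: P.shrink_def S_def)
    with vals s13(2) enterA[of False] enterA[of True] sub
    show "st' 0 = A" "st' 2 \<subseteq> A" "st' 3 \<subseteq> A" "st' 4 \<subseteq> A"
      unfolding st' I by (simp_all, blast+)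
  qed
  have "(\<lambda>j. s13 (mem j)) = (\<lambda>j. (I j \<union> P.enter I S j) - P.leave I S j)"
  proof
    fix j show "s13 (mem j) = (I j \<union> P.enter I S j) - P.leave I S j"
      using vals s13(2) by (cases j) (simp_all add: mem_def)
  qed
  then show "state st' = P.improve (state st)"
    unfolding st' using vals(3) by (simp add: state_def P.improve_def I_def S_def)
qed

text \<open>Nine nested loops suffice: for \<open>n\<close> at least 3, the bound
  \<open>Suc (card A) ^ 3\<close> on the potential is at most \<open>n ^ 9\<close>. Relations 6 and
  7 finally hold the spans of the two independent sets.\<close>

definition main_code :: com where
  "main_code = Seq (Assign 0 2 (Less 0 0)) (Seq (Assign 0 3 (Less 0 0)) (Seq (Assign 0 4 (Rel 0 0 1))
    (Seq (rept 9 0 step_code)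
    (Seq (Assign 0 5 (Rel 2 0 1)) (Seq (span_code False 6 0)
    (Seq (Assign 0 5 (Rel 3 0 1)) (span_code True 7 0)))))))"

text \<open>Levels 0 to 2 are increasing and so witness three vertices; levels 3 and 4 run over all
  pairs.\<close>

definition accept :: fm where
  "accept = Exists (Exists (Exists (Conj (Conj (Less 0 1) (Less 1 2)) (Forall (Forall (Conj (Rel 6 3 4) (Rel 7 3 4)))))))"

lemma main_code_wf: "com_wf 0 main_code" "fm_wf 0 accept"
  by (simp_all add: main_code_def accept_def span_code_wf com_wf_rept[OF step_code_wf])

lemma main_correct:
  assumes A: "st 0 = A" "A \<subseteq> square n"
  shows "eval n [] (sem n [] main_code st) accept \<longleftrightarrow> 3 \<le> n \<and>
    (\<exists>B\<subseteq>A. square n \<subseteq> dspan False B \<and> square n \<subseteq> dspan True (A - B))"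
proof (cases "3 \<le> n")
  case False
  \<comment> \<open>With fewer than three vertices the formula fails whatever the loops have
    computed.\<close>
  then have "\<not> (x < y \<and> y < z)" if "z < n" for x y z :: nat using that by linarith
  with False show ?thesis by (auto simp: accept_def)
next
  case n: True
  then have n0: "0 < n" by simp
  have "finite A" using A(2) by (rule finite_subset) (simp add: square_def)
  then interpret P: matroid_pair dspan A lex_least by (rule matroid_pair_dspan)
  note assign = sem_Assign_agree[of n "[]", OF _ n0, unfolded list.size append_Nil]
  note span = sem_span_code[OF n0, of _ _ "[]", unfolded list.size]
  define s1 where "s1 = sem n [] (Assign 0 2 (Less 0 0)) st"
  have s1: "agree {1, 2} st s1" "s1 2 = {}"
    unfolding s1_def by (subst assign; auto)+
  define s2 where "s2 = sem n [] (Assign 0 3 (Less 0 0)) s1"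
  have s2: "agree {1, 3} s1 s2" "s2 3 = {}"
    unfolding s2_def by (subst assign; auto)+
  define s3 where "s3 = sem n [] (Assign 0 4 (Rel 0 0 1)) s2"
  have s3: "agree {1, 4} s2 s3" "s3 4 = A"
    unfolding s3_def using A by (subst assign; auto simp: agreeD[OF s2(1)] agreeD[OF s1(1)])+
  note d3 = agreeD[OF s3(1)] agreeD[OF s2(1)] agreeD[OF s1(1)]
  define s4 where "s4 = sem n [] (rept 9 0 step_code) s3"
  have "s3 (mem j) = {}" for j
    using s1(2) s2(2) by (cases j) (simp_all add: mem_def d3)
  then have state3: "state s3 = (\<lambda>_. {}, A)"
    using s3(2) by (simp add: state_def)
  let ?Q = "\<lambda>s. s 0 = A \<and> s 2 \<subseteq> A \<and> s 3 \<subseteq> A \<and> s 4 \<subseteq> A"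
  have "?Q s4 \<and> state s4 = (P.improve ^^ (n ^ 9)) (state s3)"
    unfolding s4_def
  proof (rule sem_rept[where env = "[]", unfolded list.size])
    show "?Q s3" using A s1(2) s2(2) s3(2) by (simp add: d3)
    show "?Q (sem n env (step_code (length env)) st) \<and>
      state (sem n env (step_code (length env)) st) = P.improve (state st)" if "?Q st" for env st
      by (intro conjI sem_step_code[OF n0 _ A(2)]) (use that in auto)
  qed
  then have s4: "?Q s4" "(P.improve ^^ (n ^ 9)) (\<lambda>_. {}, A) = (\<lambda>j. s4 (mem j), s4 4)"
    unfolding state3 by (simp_all add: state_def)
  have "card A \<le> card (square n)" using A(2) by (intro card_mono) (simp_all add: square_def)
  then have "Suc (card A) \<le> Suc (n ^ 2)" by (simp add: square_def card_cartesian_product power2_eq_square)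
  also have "\<dots> \<le> n ^ 3"
  proof -
    have "Suc (n ^ 2) \<le> 3 * n ^ 2" using n by simp
    also have "\<dots> \<le> n * n ^ 2" using n by (intro mult_le_mono1)
    finally show ?thesis by (simp add: power3_eq_cube power2_eq_square)
  qed
  finally have "Suc (card A) ^ 3 \<le> (n ^ 3) ^ 3" by (rule power_mono) simp
  then have N: "Suc (card A) ^ 3 \<le> n ^ 9" by (simp flip: power_mult)
  define s5 where "s5 = sem n [] (Assign 0 5 (Rel 2 0 1)) s4"
  have s5: "agree {1, 5} s4 s5" "s5 5 = s4 2"
    unfolding s5_def using s4(1) A by (subst assign; auto)+
  define s6 where "s6 = sem n [] (span_code False 6 0) s5"
  have s6: "agree {1, 6} s5 s6" "s6 6 = dspan False (s4 2) \<inter> square n"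
    unfolding s6_def using span[of s5 6 False] s5(2) s4(1) A by auto
  define s7 where "s7 = sem n [] (Assign 0 5 (Rel 3 0 1)) s6"
  have s7: "agree {1, 5} s6 s7" "s7 5 = s4 3"
    unfolding s7_def using s4(1) A by (subst assign; auto simp: agreeD[OF s6(1)] agreeD[OF s5(1)])+
  define s8 where "s8 = sem n [] (span_code True 7 0) s7"
  have s8: "agree {1, 7} s7 s8" "s8 7 = dspan True (s4 3) \<inter> square n"
    unfolding s8_def using span[of s7 7 True] s7(2) s4(1) A by auto
  have s8': "s8 6 = dspan False (s4 2) \<inter> square n"
    using s6(2) by (simp add: agreeD[OF s8(1)] agreeD[OF s7(1)])
  have main: "sem n [] main_code st = s8"
    unfolding main_code_def sem.simps s1_def s2_def s3_def s4_def s5_def s6_def s7_def s8_def ..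
  have "eval n [] s8 accept \<longleftrightarrow> (\<exists>x<n. \<exists>y<n. \<exists>z<n. (x < y \<and> y < z) \<and>
      (\<forall>a<n. \<forall>b<n. (a, b) \<in> s8 6 \<and> (a, b) \<in> s8 7))"
    by (simp add: accept_def) blast
  also have "\<dots> \<longleftrightarrow> (\<forall>a<n. \<forall>b<n. (a, b) \<in> s8 6 \<and> (a, b) \<in> s8 7)"
  proof -
    have "0 < n" "1 < n" "2 < n" "(0::nat) < 1" "(1::nat) < 2" using n by simp_all
    then show ?thesis by blast
  qed
  also have "\<dots> \<longleftrightarrow> square n \<subseteq> dspan False (s4 2) \<and> square n \<subseteq> dspan True (s4 3)"
    by (auto simp: s8(2) s8')
  also have "\<dots> \<longleftrightarrow> (\<forall>j. square n \<subseteq> dspan j (s4 (mem j)))"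
    by (auto simp: all_bool_eq mem_def)
  also have "\<dots> \<longleftrightarrow> (\<exists>B\<subseteq>A. square n \<subseteq> dspan False B \<and> square n \<subseteq> dspan True (A - B))"
    using P.improve_decides[OF N s4(2) A(2)] by blast
  finally show ?thesis using n by (simp add: main)
qed

section \<open>Antistrong digraphs and the bipartite representation\<close>

lemma conn_map: "(x, y) \<in> conn R \<Longrightarrow> (g x, g y) \<in> conn (map_prod g g ` R)"
proof (induction rule: conn_induct)
  case (forward y z)
  then have "(g y, g z) \<in> map_prod g g ` R" by force
  from conn_trans[OF forward(1) conn_arc[OF this]] show ?case .
next
  case (backward y z)
  then have "(g z, g y) \<in> map_prod g g ` R" by force
  from conn_trans[OF backward(1) conn_sym[OF conn_arc[OF this]]] show ?case .
qed simp

lemma dspan_map: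
  assumes "(u, v) \<in> dspan j X"
  shows "(h u, h v) \<in> dspan j (map_prod h h ` X)"
proof -
  have "map_prod (map_sum h h) (map_sum h h) ` ends j ` X = ends j ` map_prod h h ` X"
    by (force simp: ends_def image_iff)
  with conn_map[OF assms[unfolded dspan_iff], of "map_sum h h"] show ?thesis
    by (cases j) (simp_all add: dspan_iff)
qed

definition splits :: "'v set \<Rightarrow> ('v \<times> 'v) set \<Rightarrow> bool" where
  "splits V A \<longleftrightarrow> (\<exists>B\<subseteq>A. V \<times> V \<subseteq> dspan False B \<and> V \<times> V \<subseteq> dspan True (A - B))"

text \<open>Serves to pass between vertices and their positions in a listing. Injectivity ensures
  that the image of the complement of \<open>B\<close> is the complement of its image.\<close>

lemma splits_map:
  assumes "splits V A" "inj_on h V" "A \<subseteq> V \<times> V"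
  shows "splits (h ` V) (map_prod h h ` A)"
proof -
  obtain B where B: "B \<subseteq> A" "V \<times> V \<subseteq> dspan False B" "V \<times> V \<subseteq> dspan True (A - B)"
    using assms(1) by (auto simp: splits_def)
  have "inj_on (map_prod h h) A"
    using map_prod_inj_on[OF assms(2,2)] assms(3) by (rule inj_on_subset)
  then have "map_prod h h ` A - map_prod h h ` B = map_prod h h ` (A - B)"
    using B(1) by (simp add: inj_on_image_set_diff)
  moreover have "h ` V \<times> h ` V \<subseteq> dspan j (map_prod h h ` C)" if "V \<times> V \<subseteq> dspan j C" for j C
    using that by (auto intro: dspan_map)
  ultimately show ?thesis unfolding splits_def
    using B by (intro exI[of _ "map_prod h h ` B"]) auto
qed

section \<open>Alternating walks and forward antidirected trails\<close>

lemma walk_append: "walk D x (p @ q) y \<longleftrightarrow> (\<exists>z. walk D x p z \<and> walk D z q y)"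
  if "parcs D \<subseteq> pverts D \<times> pverts D"
proof (induction p arbitrary: x)
  case Nil
  have "walk D x q y \<Longrightarrow> x \<in> pverts D" using that by (cases q) (auto split: if_splits)
  then show ?case by auto
next
  case (Cons s p)
  then show ?case by (cases s; cases "fst s"; cases "snd s") auto
qed

definition alternating :: "(('a \<times> 'a) \<times> bool) list \<Rightarrow> bool" where
  "alternating = successively (\<lambda>s t. snd s \<noteq> snd t)"

text \<open>A forward step starts at a tail copy and a backward step at a head copy; alternation
  makes consecutive steps meet in the same copy.\<close>

lemma walk_imp_dspan:
  assumes "walk D x p y" "alternating p" "p \<noteq> []" "snd (last p)"
  shows "(if snd (hd p) then Inl x else Inr x, Inr y) \<in> conn (ends False ` parcs D)"
  using assms
proof (induction p arbitrary: x)
  case (Cons s p)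
  obtain u v fw where s: "s = ((u, v), fw)" by (metis surj_pair)
  have uv: "(Inl u, Inr v) \<in> conn (ends False ` parcs D)"
    by (rule conn_arc) (use Cons.prems(1) s in \<open>force simp: ends_def\<close>)
  show ?case
  proof (cases "p = []")
    case True
    with Cons.prems s uv show ?thesis by auto
  next
    case False
    with Cons.prems s have "alternating p" "snd (hd p) \<longleftrightarrow> \<not> fw" "snd (last p)"
      by (auto simp: alternating_def successively_Cons)
    with Cons.IH[of "if fw then v else u"] Cons.prems(1) s False uv show ?thesis
      by (auto split: if_splits intro: conn_trans conn_sym)
  qed
qed simp

definition forward_alternating :: "'a pair_pre_digraph \<Rightarrow> 'a \<Rightarrow> (('a \<times> 'a) \<times> bool) list \<Rightarrow> 'a \<Rightarrow> bool" where
  "forward_alternating D x p y \<longleftrightarrow> walk D x p y \<and> alternating p \<and> p \<noteq> [] \<and> snd (hd p) \<and> snd (last p)"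

text \<open>A walk in the bipartite graph enters head copies by forward steps and tail copies by
  backward steps. Only the initial \<open>Inl x\<close> is reached without a step.\<close>

lemma dspan_imp_alternating:
  assumes D: "parcs D \<subseteq> pverts D \<times> pverts D" and "(x, y) \<in> dspan False (parcs D)"
  shows "\<exists>p. forward_alternating D x p y"
proof -
  let ?P = "\<lambda>z fw. \<exists>p. walk D x p z \<and> alternating p \<and> p \<noteq> [] \<and> snd (hd p) \<and> snd (last p) = fw"
  have ext: "walk D x (p @ [((u, v), fw)]) z \<and> alternating (p @ [((u, v), fw)])"
    if "walk D x p w" "alternating p" "p \<noteq> []" "snd (last p) = (\<not> fw)" "(u, v) \<in> parcs D"
      "w = (if fw then u else v)" "z = (if fw then v else u)" for p u v w z fw
    using that D by (auto simp: walk_append[OF D] alternating_def successively_append_iff)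
  have "(\<exists>z. w = Inr z \<and> ?P z True) \<or> (\<exists>z. w = Inl z \<and> (z = x \<or> ?P z False))"
    if "(Inl x, w) \<in> conn (ends False ` parcs D)" for w
    using that
  proof (induction rule: conn_induct)
    case (forward w z)
    then obtain u v where uv: "w = Inl u" "z = Inr v" "(u, v) \<in> parcs D"
      "u = x \<or> ?P u False" by (auto simp: ends_def)
    have "?P v True"
    proof (cases "u = x")
      case True
      with uv D show ?thesis by (intro exI[of _ "[((u, v), True)]"]) (auto simp: alternating_def)
    next
      case False
      with uv obtain p where "walk D x p u" "alternating p" "p \<noteq> []" "snd (hd p)" "\<not> snd (last p)" by auto
      with ext[of p u True u v v] uv(3) show ?thesis
        by (intro exI[of _ "p @ [((u, v), True)]"]) simp
    qed
    with uv show ?case by blast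
  next
    case (backward w z)
    then obtain u v where uv: "w = Inr v" "z = Inl u" "(u, v) \<in> parcs D"
      "?P v True" by (auto simp: ends_def)
    then obtain p where "walk D x p v" "alternating p" "p \<noteq> []" "snd (hd p)" "snd (last p)" by auto
    with ext[of p v False u v u] uv(3) have "?P u False"
      by (intro exI[of _ "p @ [((u, v), False)]"]) simp
    with uv show ?case by blast
  qed simp
  from this[of "Inr y"] assms(2) show ?thesis
    by (auto simp: dspan_iff forward_alternating_def)
qed

text \<open>A shortest alternating walk repeats no arc: the part between two uses can be cut out.\<close>

lemma alternating_imp_trail:
  assumes D: "parcs D \<subseteq> pverts D \<times> pverts D" and "forward_alternating D x p y"
  shows "\<exists>p. forward_antidirected_trail D x p y"
proof -
  define p where "p = arg_min length (\<lambda>p. forward_alternating D x p y)"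
  have p: "forward_alternating D x p y"
    unfolding p_def using assms(2) by (rule arg_min_natI)
  have min: "length p \<le> length q" if "forward_alternating D x q y" for q
    unfolding p_def using that by (rule arg_min_nat_le)
  have "distinct (map fst p)"
  proof (rule ccontr)
    assume "\<not> distinct (map fst p)"
    then obtain as bs cs a where "map fst p = as @ [a] @ bs @ [a] @ cs"
      using not_distinct_decomp by blast
    then obtain ps r where 1: "p = ps @ r" "[a] @ bs @ [a] @ cs = map fst r"
      unfolding map_eq_append_conv by blast
    obtain s r' where 2: "r = s # r'" "fst s = a" "map fst r' = bs @ [a] @ cs"
      using 1(2) by (cases r) auto
    obtain qs r'' where 3: "r' = qs @ r''" "[a] @ cs = map fst r''"
      using 2(3) unfolding map_eq_append_conv by blast
    obtain t rs where 4: "r'' = t # rs" "fst t = a"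
      using 3(2) by (cases r'') auto
    have split: "p = ps @ [s] @ qs @ [t] @ rs" and a: "fst s = a" "fst t = a"
      using 1 2 3 4 by simp_all
    have alt: "alternating (ps @ [s] @ qs @ [t] @ rs)" "walk D x (ps @ [s] @ qs @ [t] @ rs) y"
      "snd (hd (ps @ [s] @ qs @ [t] @ rs))" "snd (last (ps @ [s] @ qs @ [t] @ rs))"
      using p split by (simp_all add: forward_alternating_def)
    obtain z1 z2 z3 z4 where w: "walk D x ps z1" "walk D z1 [s] z2" "walk D z2 qs z3"
      "walk D z3 [t] z4" "walk D z4 rs y"
      using alt(2) unfolding walk_append[OF D] by blast
    obtain u v b c where st: "s = ((u, v), b)" "t = ((u, v), c)" using a by (metis surj_pair prod.collapse)
    show False
    proof (cases "b = c")
      case True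
      \<comment> \<open>Both uses start at the same vertex, so \<open>t\<close> can take the place
        of \<open>s\<close>.\<close>
      then have "s = t" "z1 = z3" using st w by (auto split: if_splits)
      then have "walk D x (ps @ [t] @ rs) y" using w unfolding walk_append[OF D] by blast
      moreover have "alternating (ps @ [t] @ rs)"
        using alt(1) \<open>s = t\<close> by (auto simp: alternating_def successively_append_iff successively_Cons)
      ultimately have "forward_alternating D x (ps @ [t] @ rs) y"
        using alt(3,4) \<open>s = t\<close> by (cases ps; cases rs) (auto simp: forward_alternating_def)
      from min[OF this] split show False by simp
    next
      case False
      \<comment> \<open>\<open>t\<close> undoes \<open>s\<close>, so both are dropped. As their
        directions differ, so do those of the steps before \<open>s\<close> and after
        \<open>t\<close>; and since the walk begins and ends forward, something remains.\<close>
      then have "z4 = z1" using st w by (auto split: if_splits)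
      then have "walk D x (ps @ rs) y" using w unfolding walk_append[OF D] by blast
      moreover have "alternating (ps @ rs)"
        using alt(1) st False
        by (cases rs; cases ps rule: rev_cases)
          (auto simp: alternating_def successively_append_iff successively_Cons)
      moreover have "ps @ rs \<noteq> []" "snd (hd (ps @ rs))" "snd (last (ps @ rs))"
        using alt st False
        by (cases rs; cases ps rule: rev_cases;
            auto simp: alternating_def successively_append_iff successively_Cons hd_append)+
      ultimately have "forward_alternating D x (ps @ rs) y"
        by (simp add: forward_alternating_def)
      from min[OF this] split show False by simp
    qed
  qed
  with p have "forward_antidirected_trail D x p y"
    by (simp add: forward_alternating_def forward_antidirected_trail_def antidirected_trail_def
        alternating_def)
  then show ?thesis ..
qed

lemma antistrong_iff:
  assumes D: "parcs D \<subseteq> pverts D \<times> pverts D"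
  shows "antistrong D \<longleftrightarrow> 3 \<le> card (pverts D) \<and> pverts D \<times> pverts D \<subseteq> dspan False (parcs D)"
proof (cases "3 \<le> card (pverts D)")
  case card: True
  let ?V = "pverts D" and ?C = "conn (ends False ` parcs D)"
  have "pverts D \<times> pverts D \<subseteq> dspan False (parcs D)" if "antistrong D"
  proof (rule subrelI)
    have neq: "(Inl x, Inr y) \<in> ?C" if xy: "x \<in> ?V" "y \<in> ?V" "x \<noteq> y" for x y
    proof -
      obtain p where "forward_antidirected_trail D x p y"
        using \<open>antistrong D\<close> xy unfolding antistrong_def by blast
      then show ?thesis
        using walk_imp_dspan[of D x p y]
        by (simp add: forward_antidirected_trail_def antidirected_trail_def alternating_def)
    qed
    fix x y assume xy: "(x, y) \<in> ?V \<times> ?V"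
    have "finite ?V" using card by (metis card.infinite not_numeral_le_zero)
    have "\<not> ?V \<subseteq> {x}" using card card_mono[of "{x}" ?V] by auto
    then obtain w where w: "w \<in> ?V" "w \<noteq> x" by blast
    have "card {x, w} \<le> 2" by (simp add: card_insert_if)
    then have "\<not> ?V \<subseteq> {x, w}" using card card_mono[of "{x, w}" ?V] by auto
    then obtain z where z: "z \<in> ?V" "z \<noteq> x" "z \<noteq> w" by blast
    \<comment> \<open>The definition covers distinct vertices only. The diagonal pair comes from
      connecting \<open>Inl x\<close>, \<open>Inr w\<close>, \<open>Inl z\<close>,
      \<open>Inr x\<close> in turn, which takes a third vertex.\<close>
    have "(Inl x, Inr x) \<in> ?C"
      using neq[of x w] neq[of z w] neq[of z x] w z xy by simp (meson conn_sym conn_trans)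
    then show "(x, y) \<in> dspan False (parcs D)"
      using neq[of x y] xy by (cases "x = y") (auto simp: dspan_iff)
  qed
  moreover have "antistrong D" if "pverts D \<times> pverts D \<subseteq> dspan False (parcs D)"
    unfolding antistrong_def
  proof (intro conjI ballI impI card)
    fix x y assume "x \<in> ?V" "y \<in> ?V"
    with that have "(x, y) \<in> dspan False (parcs D)" by blast
    then show "\<exists>p. forward_antidirected_trail D x p y"
      using dspan_imp_alternating[OF D] alternating_imp_trail[OF D] by blast
  qed
  ultimately show ?thesis using card by blast
qed (simp add: antistrong_def)

lemma dspan_True_iff: "(u, v) \<in> dspan True X \<longleftrightarrow> (u, v) \<in> conn X"
proof
  assume "(u, v) \<in> dspan True X"
  then have "(Inl u, Inl v) \<in> conn (ends True ` X)" by (simp add: dspan_iff)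
  from conn_map[OF this, of "case_sum id id"] show "(u, v) \<in> conn X"
    by (simp add: ends_def image_image case_prod_unfold)
next
  assume "(u, v) \<in> conn X"
  from conn_map[OF this, of Inl] show "(u, v) \<in> dspan True X"
    unfolding dspan_iff by (simp add: ends_def map_prod_def)
qed

text \<open>Reachability there is confined to the vertex set, which agrees with \<open>conn\<close>
  as all arcs join vertices. Nonemptiness is part of strong connectedness.\<close>

lemma connected_iff:
  assumes D: "parcs D \<subseteq> pverts D \<times> pverts D"
  shows "Digraph_Component.connected (with_proj D) \<longleftrightarrow>
    pverts D \<noteq> {} \<and> pverts D \<times> pverts D \<subseteq> dspan True (parcs D)"
proof -
  let ?V = "pverts D" and ?R = "parcs D \<union> (parcs D)\<inverse>"
  have arcs: "parcs (mk_symmetric (with_proj D)) = ?R"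
    by (auto simp: parcs_mk_symmetric)
  have "(u, v) \<in> rtrancl_on ?V ?R \<longleftrightarrow> (u, v) \<in> conn (parcs D)" if "u \<in> ?V" for u v
  proof
    show "(u, v) \<in> rtrancl_on ?V ?R \<Longrightarrow> (u, v) \<in> conn (parcs D)"
      unfolding conn_def by (rule rtrancl_on_rtranclI)
    assume "(u, v) \<in> conn (parcs D)"
    then show "(u, v) \<in> rtrancl_on ?V ?R"
      unfolding conn_def
    proof (induction rule: rtrancl_induct)
      case base
      show ?case using that by simp
    next
      case (step y z)
      then show ?case using D by (auto intro: rtrancl_on_into_rtrancl_on)
    qed
  qed
  then show ?thesis
    unfolding Digraph_Component.connected_def strongly_connected_def reachable_def
    by (auto simp: arcs dspan_True_iff)
qed

lemma splitting_iff:
  assumes "pair_digraph D"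
  shows "(\<exists>A'\<subseteq>parcs D. antistrong (D\<lparr>parcs := A'\<rparr>) \<and>
        Digraph_Component.connected (with_proj (D\<lparr>parcs := parcs D - A'\<rparr>))) \<longleftrightarrow>
    3 \<le> card (pverts D) \<and> splits (pverts D) (parcs D)"
proof -
  interpret pair_digraph D by fact
  have D: "parcs D \<subseteq> pverts D \<times> pverts D" using arc_fst_in_verts arc_snd_in_verts by fastforce
  have "antistrong (D\<lparr>parcs := A'\<rparr>) \<and>
        Digraph_Component.connected (with_proj (D\<lparr>parcs := parcs D - A'\<rparr>)) \<longleftrightarrow>
      3 \<le> card (pverts D) \<and> pverts D \<times> pverts D \<subseteq> dspan False A' \<and>
      pverts D \<times> pverts D \<subseteq> dspan True (parcs D - A')" if "A' \<subseteq> parcs D" for A'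
  proof -
    have "antistrong (D\<lparr>parcs := A'\<rparr>) \<longleftrightarrow>
        3 \<le> card (pverts D) \<and> pverts D \<times> pverts D \<subseteq> dspan False A'"
      using antistrong_iff[of "D\<lparr>parcs := A'\<rparr>"] that D by auto
    moreover have "Digraph_Component.connected (with_proj (D\<lparr>parcs := parcs D - A'\<rparr>)) \<longleftrightarrow>
        pverts D \<noteq> {} \<and> pverts D \<times> pverts D \<subseteq> dspan True (parcs D - A')"
      using connected_iff[of "D\<lparr>parcs := parcs D - A'\<rparr>"] D by auto
    ultimately show ?thesis by auto
  qed
  then show ?thesis unfolding splits_def by blast
qed

section \<open>Decoding the adjacency matrix\<close>

lemma length_concat_rows: "length (concat (map (\<lambda>u. map (f u) vs) us)) = length us * length vs"
  by (induction us) auto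

lemma nth_concat_rows:
  "i < length us \<Longrightarrow> j < length vs \<Longrightarrow>
     concat (map (\<lambda>u. map (f u) vs) us) ! (i * length vs + j) = f (us ! i) (vs ! j)"
proof (induction us arbitrary: i)
  case (Cons u us)
  then show ?case by (cases i) (auto simp: nth_append)
qed simp

theorem theorem8p2:
  shows "\<exists>P. decides_in_poly_time P
    {(D :: nat pair_pre_digraph, vs). pair_digraph D \<and> distinct vs \<and> set vs = pverts D}
    (\<lambda>(D, vs). adjacency_bits D vs)
    (\<lambda>(D, vs). \<exists>A' \<subseteq> parcs D.
        antistrong (D\<lparr>parcs := A'\<rparr>) \<and>
        Digraph_Component.connected (with_proj (D\<lparr>parcs := parcs D - A'\<rparr>)))"
proof -
  let ?P = "program main_code accept"
  let ?st = "\<lambda>n w k. if k = 0 then {(u, v). u < n \<and> v < n \<and> w ! (u * n + v)} else {}"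
  obtain p where p: "\<And>n w. length w = n * n \<Longrightarrow>
    \<exists>t \<le> poly p (length w). let c = (step ?P ^^ t) (init w) in
       halted ?P c \<and> (accepting c \<longleftrightarrow> eval n [] (sem n [] main_code (?st n w)) accept)"
    using program_decides[OF main_code_wf] by blast
  have correct: "eval (length vs) [] (sem (length vs) [] main_code (?st (length vs) (adjacency_bits D vs))) accept \<longleftrightarrow>
      (\<exists>A'\<subseteq>parcs D. antistrong (D\<lparr>parcs := A'\<rparr>) \<and>
        Digraph_Component.connected (with_proj (D\<lparr>parcs := parcs D - A'\<rparr>)))"
    if "pair_digraph D" "distinct vs" "set vs = pverts D" for D :: "nat pair_pre_digraph" and vs
  proof -
    interpret pair_digraph D by fact
    let ?n = "length vs" and ?h = "(!) vs"
    \<comment> \<open>The arcs in terms of positions in \<open>vs\<close>, as the program sees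
      them.\<close>
    define A where "A = {(u, v). u < ?n \<and> v < ?n \<and> (vs ! u, vs ! v) \<in> parcs D}"
    have D: "parcs D \<subseteq> set vs \<times> set vs"
      using arc_fst_in_verts arc_snd_in_verts that(3) by fastforce
    have A: "?st ?n (adjacency_bits D vs) 0 = A" "A \<subseteq> square ?n"
      by (auto simp: A_def adjacency_bits_def nth_concat_rows)
    have inj: "inj_on ?h {..<?n}" using that(2) by (auto simp: inj_on_def nth_eq_iff_index_eq)
    have img: "?h ` {..<?n} = set vs" by (auto simp: set_conv_nth)
    have "map_prod ?h ?h ` A = parcs D"
    proof
      show "parcs D \<subseteq> map_prod ?h ?h ` A"
      proof (rule subrelI)
        fix x y assume xy: "(x, y) \<in> parcs D"
        with D obtain u v where "u < ?n" "x = vs ! u" "v < ?n" "y = vs ! v"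
          by (metis SigmaE2 in_set_conv_nth subsetD)
        with xy show "(x, y) \<in> map_prod ?h ?h ` A" by (auto simp: A_def intro!: image_eqI[of _ _ "(u, v)"])
      qed
    qed (auto simp: A_def)
    then have forward: "splits {..<?n} A \<Longrightarrow> splits (set vs) (parcs D)"
      using splits_map[of "{..<?n}" A ?h] inj img A(2) by (simp add: square_def)
    \<comment> \<open>The inverse of the listing carries a splitting back from vertices to
      positions.\<close>
    let ?g = "the_inv_into {..<?n} ?h"
    have g: "?g (vs ! u) = u" if "u < ?n" for u
      using that inj by (simp add: the_inv_into_f_f)
    have "?g ` set vs = {..<?n}"
      using g by (auto simp: img[symmetric] image_image)
    moreover have "map_prod ?g ?g ` parcs D = A"
    proof -
      have "map_prod ?g ?g ` map_prod ?h ?h ` A = id ` A"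
        unfolding image_image by (rule image_cong) (auto simp: A_def g)
      with \<open>map_prod ?h ?h ` A = parcs D\<close> show ?thesis by simp
    qed
    moreover have "inj_on ?g (set vs)"
      using inj_on_the_inv_into[OF inj] img by simp
    ultimately have "splits (set vs) (parcs D) \<Longrightarrow> splits {..<?n} A"
      using splits_map[of "set vs" "parcs D" ?g] D by simp
    with forward have "splits {..<?n} A \<longleftrightarrow> splits (set vs) (parcs D)" by blast
    moreover have "?n = card (pverts D)" using that(2,3) by (metis distinct_card)
    ultimately show ?thesis
      unfolding main_correct[where st = "?st ?n (adjacency_bits D vs)", OF A] splitting_iff[OF that(1)]
      by (simp add: splits_def square_def that(3))
  qed
  show ?thesis
    unfolding decides_in_poly_time_def
  proof (intro exI[of _ ?P] exI[of _ p] ballI)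
    fix x :: "nat pair_pre_digraph \<times> nat list"
    assume x: "x \<in> {(D, vs). pair_digraph D \<and> distinct vs \<and> set vs = pverts D}"
    obtain D vs where Dvs: "x = (D, vs)" by fastforce
    have "length (adjacency_bits D vs) = length vs * length vs"
      by (simp add: adjacency_bits_def length_concat_rows)
    from p[OF this] correct[of D vs] x Dvs
    show "\<exists>t\<le>poly p (length (case x of (D, vs) \<Rightarrow> adjacency_bits D vs)).
        let c = (step ?P ^^ t) (init (case x of (D, vs) \<Rightarrow> adjacency_bits D vs))
        in halted ?P c \<and> (accepting c \<longleftrightarrow> (case x of (D, vs) \<Rightarrow> \<exists>A'\<subseteq>parcs D.
          antistrong (D\<lparr>parcs := A'\<rparr>) \<and>
          Digraph_Component.connected (with_proj (D\<lparr>parcs := parcs D - A'\<rparr>))))"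
      by simp
  qed
qed

end
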